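(* Let $H$ be a separable Hilbert space with a fixed orthonormal basis $\{e_n\}_{n\in\mathbb N}$. The group $GL_f(H)$ of invertible elements of the $C^*$-algebra $\mathbb B_f(H)$, with the norm topology, is contractible.
   Context: For a Hilbert space $H$ with fixed orthonormal basis $\{e_n\}_{n\in\mathbb N}$, $\mathbb B(H)$ denotes the bounded operators, and operators are identified with their matrices with respect to this basis. For $k\in\mathbb N$, $\mathbb B^{(k)}(H)$ is the set of all $a\in\mathbb B(H)$ whose matrix has no more than $k$ non-zero entries in each line (row) and no more than $k$ non-zero entries in each column. $\mathbb B^{(\infty)}(H)=\bigcup_{k\in\mathbb N}\mathbb B^{(k)}(H)$, and $\mathbb B_f(H)$ is the operator-norm closure of $\mathbb B^{(\infty)}(H)$ in $\mathbb B(H)$; it is a unital $C^*$-subalgebra of $\mathbb B(H)$. *)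

theory Defs
  imports "HOL-Analysis.Analysis"
begin

text \<open>
  Complex Hilbert spaces, as an extension of the library's Banach spaces: the complex scalar
  multiplication extends the real one, and the inner product (linear in the first argument,
  conjugate-linear in the second) induces the given complete norm.
\<close>

class chilbert_space = banach +
  fixes scaleC :: "complex \<Rightarrow> 'a \<Rightarrow> 'a" (infixr \<open>*\<^sub>C\<close> 75)
    and cinner :: "'a \<Rightarrow> 'a \<Rightarrow> complex"
  assumes scaleC_add_right: "c *\<^sub>C (x + y) = c *\<^sub>C x + c *\<^sub>C y"
    and scaleC_add_left: "(c + d) *\<^sub>C x = c *\<^sub>C x + d *\<^sub>C x"
    and scaleC_scaleC: "c *\<^sub>C d *\<^sub>C x = (c * d) *\<^sub>C x"
    and scaleC_of_real: "complex_of_real r *\<^sub>C x = r *\<^sub>R x"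
    and cinner_add_left: "cinner (x + y) z = cinner x z + cinner y z"
    and cinner_scaleC_left: "cinner (c *\<^sub>C x) y = c * cinner x y"
    and cinner_commute: "cinner x y = cnj (cinner y x)"
    and cinner_self: "cinner x x = complex_of_real ((norm x)\<^sup>2)"

lemma vector_space_scaleC: "vector_space (scaleC :: complex \<Rightarrow> 'a \<Rightarrow> 'a::chilbert_space)"
proof
  fix x :: 'a
  show "1 *\<^sub>C x = x"
    using scaleC_of_real[of 1 x] by simp
qed (simp_all add: scaleC_add_right scaleC_add_left scaleC_scaleC)

definition orthonormal_basis :: "(nat \<Rightarrow> 'a::chilbert_space) \<Rightarrow> bool" where
  "orthonormal_basis e \<longleftrightarrow>
     (\<forall>m n. cinner (e m) (e n) = (if m = n then 1 else 0)) \<and>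
     closure (module.span scaleC (range e)) = UNIV"

text \<open>
  \<open>\<bool>(H)\<close>. The elements of the library type \<open>'a \<Rightarrow>\<^sub>L 'a\<close> are the real-linear bounded operators, with
  the operator norm; the complex-linear ones are singled out as a subset.
\<close>

definition bounded_operators :: "('a::chilbert_space \<Rightarrow>\<^sub>L 'a) set" where
  "bounded_operators = {a. \<forall>c x. blinfun_apply a (c *\<^sub>C x) = c *\<^sub>C blinfun_apply a x}"

definition matrix_entry ::
    "(nat \<Rightarrow> 'a::chilbert_space) \<Rightarrow> ('a \<Rightarrow>\<^sub>L 'a) \<Rightarrow> nat \<Rightarrow> nat \<Rightarrow> complex" where
  "matrix_entry e a i j = cinner (blinfun_apply a (e j)) (e i)"

definition B_at_most :: "(nat \<Rightarrow> 'a::chilbert_space) \<Rightarrow> nat \<Rightarrow> ('a \<Rightarrow>\<^sub>L 'a) set" where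
  "B_at_most e k = {a \<in> bounded_operators.
     (\<forall>i. finite {j. matrix_entry e a i j \<noteq> 0} \<and> card {j. matrix_entry e a i j \<noteq> 0} \<le> k) \<and>
     (\<forall>j. finite {i. matrix_entry e a i j \<noteq> 0} \<and> card {i. matrix_entry e a i j \<noteq> 0} \<le> k)}"

definition B_infty :: "(nat \<Rightarrow> 'a::chilbert_space) \<Rightarrow> ('a \<Rightarrow>\<^sub>L 'a) set" where
  "B_infty e = (\<Union>k. B_at_most e k)"

text \<open>
  The closure is formed in \<open>'a \<Rightarrow>\<^sub>L 'a\<close>; since \<open>bounded_operators\<close> is closed there
  (\<open>closed_bounded_operators\<close> below), this is the closure in \<open>\<bool>(H)\<close>.
\<close>

definition B_f :: "(nat \<Rightarrow> 'a::chilbert_space) \<Rightarrow> ('a \<Rightarrow>\<^sub>L 'a) set" where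
  "B_f e = closure (B_infty e)"

definition GL_f :: "(nat \<Rightarrow> 'a::chilbert_space) \<Rightarrow> ('a \<Rightarrow>\<^sub>L 'a) set" where
  "GL_f e = {a \<in> B_f e. \<exists>b \<in> B_f e. a o\<^sub>L b = id_blinfun \<and> b o\<^sub>L a = id_blinfun}"

lemma norm_scaleC: "norm (c *\<^sub>C x) = cmod c * norm (x :: 'a::chilbert_space)"
proof -
  have "cinner (c *\<^sub>C x) (c *\<^sub>C x) = c * cnj (c * cinner x x)"
    by (metis cinner_scaleC_left cinner_commute)
  also have "\<dots> = (c * cnj c) * complex_of_real ((norm x)\<^sup>2)"
    by (simp add: cinner_self)
  also have "\<dots> = complex_of_real ((cmod c * norm x)\<^sup>2)"
    by (simp add: complex_norm_square[symmetric] power_mult_distrib)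
  finally have "complex_of_real ((norm (c *\<^sub>C x))\<^sup>2) = complex_of_real ((cmod c * norm x)\<^sup>2)"
    by (simp add: cinner_self)
  then have "(norm (c *\<^sub>C x))\<^sup>2 = (cmod c * norm x)\<^sup>2"
    by (simp only: of_real_eq_iff)
  then show ?thesis
    by (rule power2_eq_imp_eq) simp_all
qed

lemma bounded_linear_scaleC: "bounded_linear (\<lambda>x :: 'a::chilbert_space. c *\<^sub>C x)"
proof (rule bounded_linear_intro[where K = "cmod c"])
  show "c *\<^sub>C (r *\<^sub>R x) = r *\<^sub>R (c *\<^sub>C x)" for r and x :: 'a
    by (metis scaleC_of_real scaleC_scaleC mult.commute)
qed (simp_all add: scaleC_add_right norm_scaleC mult.commute)

lemma closed_bounded_operators: "closed (bounded_operators :: ('a::chilbert_space \<Rightarrow>\<^sub>L 'a) set)"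
proof -
  have "closed {a :: 'a \<Rightarrow>\<^sub>L 'a. blinfun_apply a (c *\<^sub>C x) = c *\<^sub>C blinfun_apply a x}" for c x
    by (intro closed_Collect_eq bounded_linear.continuous_on[OF bounded_linear_scaleC]
        bounded_linear.continuous_on[OF blinfun.bounded_linear_left] continuous_on_id)
  then show ?thesis
    unfolding bounded_operators_def by (intro closed_Collect_all)
qed

lemma B_f_subset_bounded_operators: "B_f e \<subseteq> bounded_operators"
  unfolding B_f_def
  by (rule closure_minimal[OF _ closed_bounded_operators])
     (auto simp: B_infty_def B_at_most_def)

end

theory Submission
  imports Defs
begin

text \<open>
  The contraction is written down globally, so that no comparison of weak contractibility with
  contractibility (CW type) is needed. To every \<open>x\<close> in \<open>GL_f(H)\<close> one attaches, continuously in \<open>x\<close>,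
  isometries \<open>J(x)\<close> and \<open>K(x)\<close> in \<open>\<bool>_f(H)\<close> with orthogonal ranges such that \<open>K* x J\<close> is small.
  As in Kuiper's proof, \<open>x\<close> is perturbed until \<open>K* x J = 0\<close>, \<open>x J\<close> is rotated into \<open>K\<close> and \<open>K\<close> into \<open>J\<close>,
  so that \<open>x\<close> becomes the identity on the range of \<open>J\<close>; the range of \<open>J\<close> then provides the room
  for an Eilenberg swindle.

  Each \<open>x\<close> is close to banded matrices \<open>a\<close>. For a finite set \<open>F\<close> of banded matrices one finds a
  sequence of basis vectors whose members are not related by any \<open>a \<in> F\<close>, and hence basis-to-basis
  isometries \<open>J_F\<close> and \<open>K_F\<close> with \<open>K_F* a J_F = 0\<close>. A partition of unity on \<open>GL_f(H)\<close>, subdivided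
  barycentrically, has the property that the sets \<open>F\<close> active at \<open>x\<close> form a chain; the isometries are
  mixed as \<open>J = \<Sum> c_F J_F\<close> with \<open>\<Sum> c_F^2 = 1\<close>. A matrix \<open>a\<close> in the smallest active set belongs to all
  active sets, so \<open>K* a J = 0\<close> for that \<open>a\<close>, which gives the smallness of \<open>K* x J\<close>.
\<close>

section \<open>Invertible elements of a closed operator algebra\<close>

text \<open>The isometries must lie in \<open>B_f e\<close>; this holds for maps sending basis
  vectors to distinct basis vectors and for finite mixtures of them. A mixture with square-summing
  coefficients is an isometry if its summands have orthogonal ranges, and the mixed product contains
  cross terms of \<open>K_F'\<close> with \<open>a\<close> and \<open>J_G\<close>; both conditions
  compare the choices made for two different sets. There are uncountably many finite sets of banded
  matrices, so their sequences cannot all be pairwise disjoint. The subdivision reduces the demand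
  to nested pairs: a finite set has only finitely many proper subsets, so a recursion over strict
  inclusion can meet it. "Small" means \<open>norm (ginv x) * norm (x - a) < 1\<close>: this keeps
  \<open>x - s K K' x J J'\<close> invertible for all \<open>s\<close> in [0,1]. With
  \<open>D w\<close> the infinite direct sum of copies of \<open>w\<close>, and up to identity
  summands, the swindle reads w = w + (D w)^-1 + D w = (w + D w) + (D w)^-1 = D w + (D w)^-1 = 1,
  where + is the direct sum and summands change places by rotations.\<close>

lemma blinfun_compose_apply_eq: "a o\<^sub>L b = c \<Longrightarrow> blinfun_apply a (blinfun_apply b v) = blinfun_apply c v"
  by (metis blinfun_apply_blinfun_compose)

lemma blinfun_compose_id [simp]: "id_blinfun o\<^sub>L a = a" "a o\<^sub>L id_blinfun = a"
  by (auto intro: blinfun_eqI)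

lemma blinfun_compose_assoc: "(a o\<^sub>L b) o\<^sub>L c = a o\<^sub>L (b o\<^sub>L c)"
  by (auto intro: blinfun_eqI)

locale operator_algebra =
  fixes B :: "('a::banach \<Rightarrow>\<^sub>L 'a) set"
  assumes closed_carrier: "closed B"
    and id_mem: "id_blinfun \<in> B"
    and add_mem: "a \<in> B \<Longrightarrow> b \<in> B \<Longrightarrow> a + b \<in> B"
    and scaleR_mem: "a \<in> B \<Longrightarrow> r *\<^sub>R a \<in> B"
    and compose_mem: "a \<in> B \<Longrightarrow> b \<in> B \<Longrightarrow> a o\<^sub>L b \<in> B"
begin

lemma diff_mem: "a \<in> B \<Longrightarrow> b \<in> B \<Longrightarrow> a - b \<in> B"
  using add_mem[of a "(-1) *\<^sub>R b"] scaleR_mem[of b "-1"] by simp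

lemma zero_mem: "0 \<in> B"
  using diff_mem[OF id_mem id_mem] by simp

lemma sum_mem: "(\<And>i. i \<in> A \<Longrightarrow> f i \<in> B) \<Longrightarrow> (\<Sum>i\<in>A. f i) \<in> B"
  by (induction A rule: infinite_finite_induct) (auto simp: zero_mem add_mem)

lemmas mem_intros = id_mem add_mem scaleR_mem compose_mem diff_mem

definition GL where
  "GL = {a \<in> B. \<exists>b\<in>B. a o\<^sub>L b = id_blinfun \<and> b o\<^sub>L a = id_blinfun}"

definition ginv where
  "ginv a = (SOME b. b \<in> B \<and> a o\<^sub>L b = id_blinfun \<and> b o\<^sub>L a = id_blinfun)"

lemma GL_I:
  "a \<in> B \<Longrightarrow> b \<in> B \<Longrightarrow> a o\<^sub>L b = id_blinfun \<Longrightarrow> b o\<^sub>L a = id_blinfun \<Longrightarrow> a \<in> GL"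
  unfolding GL_def by blast

lemma GL_mem: "a \<in> GL \<Longrightarrow> a \<in> B"
  unfolding GL_def by blast

lemma
  assumes "a \<in> GL"
  shows ginv_mem: "ginv a \<in> B"
    and ginv_right: "a o\<^sub>L ginv a = id_blinfun"
    and ginv_left: "ginv a o\<^sub>L a = id_blinfun"
proof -
  have "\<exists>b. b \<in> B \<and> a o\<^sub>L b = id_blinfun \<and> b o\<^sub>L a = id_blinfun"
    using assms unfolding GL_def by blast
  from someI_ex[OF this] show "ginv a \<in> B" "a o\<^sub>L ginv a = id_blinfun" "ginv a o\<^sub>L a = id_blinfun"
    unfolding ginv_def by auto
qed

lemma ginv_apply:
  assumes "a \<in> GL"
  shows "blinfun_apply a (blinfun_apply (ginv a) v) = v"
    and "blinfun_apply (ginv a) (blinfun_apply a v) = v"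
  using ginv_right[OF assms] ginv_left[OF assms] blinfun_compose_apply_eq by fastforce+

lemma ginv_in_GL: "a \<in> GL \<Longrightarrow> ginv a \<in> GL"
  using GL_I[of "ginv a" a] by (simp add: GL_mem ginv_mem ginv_right ginv_left)


lemma compose_GL:
  assumes "a \<in> GL" "b \<in> GL"
  shows "a o\<^sub>L b \<in> GL"
proof (rule GL_I[of _ "ginv b o\<^sub>L ginv a"])
qed (use assms in \<open>auto intro!: blinfun_eqI simp: ginv_apply compose_mem GL_mem ginv_mem\<close>)

lemma norm_ginv_diff:
  assumes "a \<in> GL" "b \<in> GL"
  shows "norm (ginv b - ginv a) \<le> norm (ginv a) * norm (a - b) * norm (ginv b)"
proof -
  have "ginv b - ginv a = ginv a o\<^sub>L (a - b) o\<^sub>L ginv b"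
    by (rule blinfun_eqI) (simp add: blinfun.bilinear_simps ginv_apply assms)
  also have "norm \<dots> \<le> norm (ginv a) * norm (a - b) * norm (ginv b)"
    by (meson mult_right_mono norm_blinfun_compose norm_ge_zero order_trans)
  finally show ?thesis .
qed

lemma norm_ginv_pos:
  assumes "a \<in> GL" "(UNIV :: 'a set) \<noteq> {0}"
  shows "norm (ginv a) > 0"
proof -
  obtain v :: 'a where "v \<noteq> 0"
    using assms(2) by auto
  then have "ginv a \<noteq> 0"
    using ginv_apply(1)[OF assms(1), of v] by auto
  then show ?thesis
    by simp
qed

text \<open>This is the resolvent estimate divided by both norms. It serves twice: it controls the
  norm of the inverse in the proof that inversion is continuous, and it makes the radius of the bump
  functions below Lipschitz.\<close>

lemma inverse_norm_ginv_Lipschitz: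
  assumes "a \<in> GL" "b \<in> GL" "(UNIV :: 'a set) \<noteq> {0}"
  shows "\<bar>1 / norm (ginv a) - 1 / norm (ginv b)\<bar> \<le> norm (a - b)"
proof -
  have *: "1 / norm (ginv a) \<le> 1 / norm (ginv b) + norm (a - b)" if "a \<in> GL" "b \<in> GL" for a b
  proof -
    have pos: "norm (ginv a) > 0" "norm (ginv b) > 0"
      using norm_ginv_pos that assms(3) by auto
    have "norm (ginv b) \<le> norm (ginv a) + norm (ginv b - ginv a)"
      by (metis add.commute diff_add_cancel norm_triangle_ineq)
    then have "norm (ginv b) \<le> norm (ginv a) + norm (ginv a) * norm (a - b) * norm (ginv b)"
      using norm_ginv_diff[OF that] by linarith
    with pos show ?thesis
      by (simp add: field_simps)
  qed
  show ?thesis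
    using *[OF assms(1,2)] *[OF assms(2,1)] by (simp add: norm_minus_commute abs_le_iff)
qed

lemma continuous_on_ginv: "continuous_on GL ginv"
proof (cases "(UNIV :: 'a set) = {0}")
  case True
  then have "a = b" for a b :: "'a \<Rightarrow>\<^sub>L 'a"
    by (intro blinfun_eqI) (metis UNIV_I singletonD)
  then have "ginv = (\<lambda>_. 0)"
    by blast
  then show ?thesis
    by simp
next
  case False
  have "1-lipschitz_on GL (\<lambda>a. 1 / norm (ginv a))"
    using inverse_norm_ginv_Lipschitz False by (intro lipschitz_onI) (auto simp: dist_norm)
  then have "continuous_on GL (\<lambda>a. 1 / norm (ginv a))"
    by (rule lipschitz_on_continuous_on)
  then have "continuous_on GL (\<lambda>a. inverse (1 / norm (ginv a)))"
    by (rule continuous_on_inverse) (use norm_ginv_pos[OF _ False] in auto)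
  then have cn: "continuous_on GL (\<lambda>a. norm (ginv a))"
    by (simp add: inverse_eq_divide)
  show ?thesis
    unfolding continuous_on_def
  proof
    fix a assume a: "a \<in> GL"
    have "((\<lambda>b. norm (ginv b)) \<longlongrightarrow> norm (ginv a)) (at a within GL)"
      using cn a by (simp add: continuous_on_def)
    then have "((\<lambda>b. norm (ginv a) * norm (a - b) * norm (ginv b)) \<longlongrightarrow>
        norm (ginv a) * norm (a - a) * norm (ginv a)) (at a within GL)"
      by (intro tendsto_mult[OF tendsto_mult] tendsto_norm[OF tendsto_diff] tendsto_const tendsto_ident_at)
    then have "((\<lambda>b. norm (ginv a) * norm (a - b) * norm (ginv b)) \<longlongrightarrow> 0) (at a within GL)"
      by simp
    then have "((\<lambda>b. ginv b - ginv a) \<longlongrightarrow> 0) (at a within GL)"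
      by (rule Lim_null_comparison[rotated])
         (use norm_ginv_diff[OF a] in \<open>auto simp: eventually_at_filter\<close>)
    then show "(ginv \<longlongrightarrow> ginv a) (at a within GL)"
      by (rule LIM_zero_cancel)
  qed
qed

text \<open>Neumann series. Its partial sums lie in \<open>B\<close>, and closedness of
  \<open>B\<close> keeps the limit there.\<close>

lemma id_minus_GL:
  assumes "u \<in> B" "norm u < 1"
  shows "id_blinfun - u \<in> GL"
proof -
  define p where "p n = ((o\<^sub>L) u ^^ n) id_blinfun" for n
  have p_Suc: "p (Suc n) = u o\<^sub>L p n" for n
    by (simp add: p_def)
  have p_Suc': "p (Suc n) = p n o\<^sub>L u" for n
    by (induction n) (simp_all add: p_def flip: blinfun_compose_assoc)
  have p_mem: "p n \<in> B" for n
    by (induction n) (simp_all add: p_Suc compose_mem assms(1), simp add: p_def id_mem)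
  have p_norm: "norm (p n) \<le> norm u ^ n * norm (id_blinfun :: 'a \<Rightarrow>\<^sub>L 'a)" for n
  proof (induction n)
    case (Suc n)
    have "norm (p (Suc n)) \<le> norm u * norm (p n)"
      by (simp add: p_Suc norm_blinfun_compose)
    also have "\<dots> \<le> norm u * (norm u ^ n * norm (id_blinfun :: 'a \<Rightarrow>\<^sub>L 'a))"
      using Suc by (intro mult_left_mono) auto
    finally show ?case
      by (simp add: mult_ac)
  qed (simp add: p_def)
  have "summable (\<lambda>n. norm u ^ n * norm (id_blinfun :: 'a \<Rightarrow>\<^sub>L 'a))"
    using assms(2) by (intro summable_mult2 summable_geometric) simp
  then have sp: "summable p"
    by (rule summable_comparison_test') (use p_norm in auto)
  define q where "q = suminf p"
  have pq: "p sums q"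
    unfolding q_def using sp by (rule summable_sums)
  have "q \<in> B"
    by (rule Lim_in_closed_set[OF closed_carrier _ _ pq[unfolded sums_def]])
       (auto intro!: always_eventually sum_mem p_mem)
  have p0: "p 0 = id_blinfun"
    by (simp add: p_def)
  have q1: "(\<lambda>n. p (Suc n)) sums (q - id_blinfun)"
    using pq sums_Suc_iff[of p "q - p 0"] by (simp add: p0)
  have "(\<lambda>n. u o\<^sub>L p n) sums (u o\<^sub>L q)"
    by (rule bounded_linear.sums[OF bounded_bilinear.bounded_linear_right[OF bounded_bilinear_blinfun_compose] pq])
  then have 1: "u o\<^sub>L q = q - id_blinfun"
    using q1 sums_unique2 unfolding p_Suc by blast
  have "(\<lambda>n. p n o\<^sub>L u) sums (q o\<^sub>L u)"
    by (rule bounded_linear.sums[OF bounded_bilinear.bounded_linear_left[OF bounded_bilinear_blinfun_compose] pq])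
  then have 2: "q o\<^sub>L u = q - id_blinfun"
    using q1 sums_unique2 unfolding p_Suc' by blast
  show ?thesis
  proof (rule GL_I[OF _ \<open>q \<in> B\<close>])
    show "id_blinfun - u \<in> B"
      by (intro mem_intros assms)
  qed (auto intro!: blinfun_eqI simp: blinfun.bilinear_simps
      blinfun_compose_apply_eq[OF 1] blinfun_compose_apply_eq[OF 2])
qed

end

section \<open>Rotations and the swindle\<close>

text \<open>
  The rotation by the angle \<open>t\<close> in the plane spanned by the isometric copies \<open>a\<close> and \<open>b\<close> of the
  whole space; \<open>a'\<close> and \<open>b'\<close> are left inverses that vanish on the other copy.
\<close>

definition rot :: "('a::real_normed_vector \<Rightarrow>\<^sub>L 'a) \<Rightarrow> ('a \<Rightarrow>\<^sub>L 'a) \<Rightarrow> ('a \<Rightarrow>\<^sub>L 'a) \<Rightarrow> ('a \<Rightarrow>\<^sub>L 'a) \<Rightarrow> real \<Rightarrow> ('a \<Rightarrow>\<^sub>L 'a)" where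
  "rot a a' b b' t = id_blinfun - ((a o\<^sub>L a') + (b o\<^sub>L b'))
     + cos t *\<^sub>R ((a o\<^sub>L a') + (b o\<^sub>L b')) + sin t *\<^sub>R ((b o\<^sub>L a') - (a o\<^sub>L b'))"

text \<open>If \<open>a'\<close> is a left inverse of \<open>a\<close>, this is the direct sum of
  \<open>u\<close>, transplanted to the range of \<open>a\<close>, and the identity on the kernel of
  \<open>a'\<close>.\<close>

definition extend :: "('a::real_normed_vector \<Rightarrow>\<^sub>L 'a) \<Rightarrow> ('a \<Rightarrow>\<^sub>L 'a) \<Rightarrow> ('a \<Rightarrow>\<^sub>L 'a) \<Rightarrow> ('a \<Rightarrow>\<^sub>L 'a)" where
  "extend a a' u = (a o\<^sub>L u o\<^sub>L a') + (id_blinfun - (a o\<^sub>L a'))"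

lemma continuous_on_rot [continuous_intros]:
  fixes S :: "'b::t2_space set"
  assumes "continuous_on S a" "continuous_on S a'" "continuous_on S b" "continuous_on S b'"
    and "continuous_on S t"
  shows "continuous_on S (\<lambda>x. rot (a x) (a' x) (b x) (b' x) (t x))"
  unfolding rot_def by (intro continuous_intros assms)

lemma continuous_on_extend [continuous_intros]:
  assumes "continuous_on S a" "continuous_on S a'" "continuous_on S u"
  shows "continuous_on S (\<lambda>x. extend (a x) (a' x) (u x))"
  unfolding extend_def by (intro continuous_intros assms)

lemma extend_compose:
  assumes "a' o\<^sub>L a = id_blinfun"
  shows "extend a a' u o\<^sub>L extend a a' v = extend a a' (u o\<^sub>L v)"
  unfolding extend_def
  by (rule blinfun_eqI) (simp add: blinfun.bilinear_simps blinfun_compose_apply_eq[OF assms])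

lemma extend_id: "extend a a' id_blinfun = id_blinfun"
  unfolding extend_def by simp

lemma rot_0 [simp]: "rot a a' b b' 0 = id_blinfun"
  unfolding rot_def by simp

locale isometry_pair =
  fixes a a' b b' :: "'a::banach \<Rightarrow>\<^sub>L 'a"
  assumes rel: "a' o\<^sub>L a = id_blinfun" "b' o\<^sub>L b = id_blinfun" "a' o\<^sub>L b = 0" "b' o\<^sub>L a = 0"
begin

lemma rel_apply:
  "blinfun_apply a' (blinfun_apply a v) = v" "blinfun_apply b' (blinfun_apply b v) = v"
  "blinfun_apply a' (blinfun_apply b v) = 0" "blinfun_apply b' (blinfun_apply a v) = 0"
  using rel by (auto dest: blinfun_compose_apply_eq[where v = v])

lemma rot_minus: "rot a a' b b' t o\<^sub>L rot a a' b b' (-t) = id_blinfun"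
proof (rule blinfun_eqI)
  fix v
  have "cos t * cos t = 1 - sin t * sin t"
    using sin_cos_squared_add3[of t] by linarith
  then have cs: "(cos t * cos t) *\<^sub>R x = x - (sin t * sin t) *\<^sub>R x" for x :: 'a
    by (simp only: scaleR_left_diff_distrib scaleR_one)
  show "blinfun_apply (rot a a' b b' t o\<^sub>L rot a a' b b' (-t)) v = blinfun_apply id_blinfun v"
    unfolding rot_def
    by (simp add: blinfun.bilinear_simps rel_apply algebra_simps cs)
qed

lemma rot_pi_half: "rot a a' b b' (pi/2) o\<^sub>L a = b"
  unfolding rot_def by (rule blinfun_eqI) (simp add: blinfun.bilinear_simps rel_apply)

text \<open>The quarter turn takes the copy \<open>a\<close> to \<open>b\<close> and
  \<open>b\<close> to minus \<open>a\<close>; the sign cancels under conjugation.\<close>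

lemma rot_extend:
  "rot a a' b b' (pi/2) o\<^sub>L extend a a' u o\<^sub>L rot a a' b b' (-(pi/2)) = extend b b' u"
  unfolding rot_def extend_def
  by (rule blinfun_eqI) (simp add: blinfun.bilinear_simps rel_apply)

end

context isometry_pair
begin
lemma rot_GL:
  assumes "operator_algebra B" "a \<in> B" "a' \<in> B" "b \<in> B" "b' \<in> B"
  shows "rot a a' b b' t \<in> operator_algebra.GL B"
proof -
  interpret operator_algebra B by fact
  have "rot a a' b b' t \<in> B" for t
    unfolding rot_def by (intro mem_intros assms)
  then show ?thesis
    using rot_minus[of t] rot_minus[of "-t"] by (intro GL_I[of _ "rot a a' b b' (-t)"]) auto
qed
end

section \<open>Deformations inside the group of invertible elements\<close>

context operator_algebra
begin

lemma extend_mem: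
  assumes "a \<in> B" "a' \<in> B" "u \<in> B"
  shows "extend a a' u \<in> B"
  unfolding extend_def by (intro mem_intros assms)

lemma extend_GL:
  assumes "a' o\<^sub>L a = id_blinfun" "a \<in> B" "a' \<in> B" "u \<in> GL"
  shows "extend a a' u \<in> GL"
proof (rule GL_I[of _ "extend a a' (ginv u)"])
qed (use assms in \<open>auto simp: extend_compose ginv_right ginv_left extend_id
       intro!: extend_mem GL_mem[of u] ginv_mem\<close>)

lemma id_minus_nilpotent_GL:
  assumes "n \<in> B" "n o\<^sub>L n = 0"
  shows "id_blinfun - n \<in> GL"
proof (rule GL_I[of _ "id_blinfun + n"])
qed (use assms in \<open>auto simp: blinfun.bilinear_simps blinfun_compose_apply_eq[OF assms(2)]
       intro!: mem_intros blinfun_eqI\<close>)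

lemma homotopicI:
  fixes h :: "real \<Rightarrow> ('a \<Rightarrow>\<^sub>L 'a) \<Rightarrow> ('a \<Rightarrow>\<^sub>L 'a)"
  assumes "continuous_on ({0..1} \<times> GL) (\<lambda>p. h (fst p) (snd p))"
    and "\<And>t x. t \<in> {0..1} \<Longrightarrow> x \<in> GL \<Longrightarrow> h t x \<in> GL"
    and "\<And>x. x \<in> GL \<Longrightarrow> h 0 x = f x" "\<And>x. x \<in> GL \<Longrightarrow> h 1 x = g x"
  shows "homotopic_with_canon (\<lambda>x. True) GL GL f g"
proof (rule homotopic_with[THEN iffD2])
  show "\<exists>k. continuous_map (prod_topology (top_of_set {0..1::real}) (top_of_set GL)) (top_of_set GL) k \<and>
      (\<forall>x\<in>topspace (top_of_set GL). k (0, x) = f x) \<and>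
      (\<forall>x\<in>topspace (top_of_set GL). k (1, x) = g x) \<and> (\<forall>t\<in>{0..1::real}. True)"
    by (rule exI[of _ "\<lambda>p. h (fst p) (snd p)"]) (use assms in \<open>auto simp: Pi_iff\<close>)
qed simp

lemma continuous_on_ginv_compose [continuous_intros]:
  "continuous_on S f \<Longrightarrow> f ` S \<subseteq> GL \<Longrightarrow> continuous_on S (\<lambda>x. ginv (f x))"
  using continuous_on_compose2[OF continuous_on_ginv] by blast

text \<open>Relative to the range of \<open>J x\<close> and the kernel of \<open>J' x\<close>, the
  two conclusions make \<open>w x\<close> block diagonal with the identity in the corner of the
  room: each of them removes one off-diagonal block. The swindle needs this form.\<close>

lemma homotopic_to_fixing:
  fixes J J' K K' :: "('a \<Rightarrow>\<^sub>L 'a) \<Rightarrow> ('a \<Rightarrow>\<^sub>L 'a)"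
  assumes cont: "continuous_on GL J" "continuous_on GL J'" "continuous_on GL K" "continuous_on GL K'"
    and mem: "\<And>x. x \<in> GL \<Longrightarrow> J x \<in> B" "\<And>x. x \<in> GL \<Longrightarrow> J' x \<in> B"
      "\<And>x. x \<in> GL \<Longrightarrow> K x \<in> B" "\<And>x. x \<in> GL \<Longrightarrow> K' x \<in> B"
    and rel: "\<And>x. x \<in> GL \<Longrightarrow> J' x o\<^sub>L J x = id_blinfun" "\<And>x. x \<in> GL \<Longrightarrow> K' x o\<^sub>L K x = id_blinfun"
      "\<And>x. x \<in> GL \<Longrightarrow> J' x o\<^sub>L K x = 0" "\<And>x. x \<in> GL \<Longrightarrow> K' x o\<^sub>L J x = 0"
    and small: "\<And>x. x \<in> GL \<Longrightarrow> norm (ginv x o\<^sub>L (K x o\<^sub>L K' x o\<^sub>L x o\<^sub>L J x o\<^sub>L J' x)) < 1"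
  obtains w where "homotopic_with_canon (\<lambda>x. True) GL GL id w"
    "\<And>x. x \<in> GL \<Longrightarrow> w x o\<^sub>L J x = J x" "\<And>x. x \<in> GL \<Longrightarrow> J' x o\<^sub>L w x = J' x"
proof -
  have rel_apply:
    "blinfun_apply (J' x) (blinfun_apply (J x) v) = v" "blinfun_apply (K' x) (blinfun_apply (K x) v) = v"
    "blinfun_apply (J' x) (blinfun_apply (K x) v) = 0" "blinfun_apply (K' x) (blinfun_apply (J x) v) = 0"
    if "x \<in> GL" for x v
    using rel[OF that] by (auto dest: blinfun_compose_apply_eq[where v = v])
  have snd_cont: "continuous_on (T \<times> GL) (\<lambda>p. f (snd p))"
    if "continuous_on GL f" for f :: "('a \<Rightarrow>\<^sub>L 'a) \<Rightarrow> 'a \<Rightarrow>\<^sub>L 'a" and T :: "real set"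
    by (rule continuous_on_compose2[OF that]) (auto intro!: continuous_intros)
  \<comment> \<open>Writing the perturbed element as \<open>x o\<^sub>L g s x\<close> reduces its
    invertibility to that of a small perturbation of the identity.\<close>
  define g where "g s x = id_blinfun - s *\<^sub>R (ginv x o\<^sub>L (K x o\<^sub>L K' x o\<^sub>L x o\<^sub>L J x o\<^sub>L J' x))" for s x
  define f where "f s x = x o\<^sub>L g s x" for s x
  have g_GL: "g s x \<in> GL" if "s \<in> {0..1}" "x \<in> GL" for s x
    unfolding g_def
  proof (rule id_minus_GL)
    show "s *\<^sub>R (ginv x o\<^sub>L (K x o\<^sub>L K' x o\<^sub>L x o\<^sub>L J x o\<^sub>L J' x)) \<in> B"
      using that by (intro scaleR_mem compose_mem mem GL_mem[OF \<open>x \<in> GL\<close>] ginv_mem)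
    have "norm (s *\<^sub>R (ginv x o\<^sub>L (K x o\<^sub>L K' x o\<^sub>L x o\<^sub>L J x o\<^sub>L J' x)))
        \<le> 1 * norm (ginv x o\<^sub>L (K x o\<^sub>L K' x o\<^sub>L x o\<^sub>L J x o\<^sub>L J' x))"
      using that by (subst norm_scaleR, intro mult_right_mono) auto
    with small[OF that(2)] show "norm (s *\<^sub>R (ginv x o\<^sub>L (K x o\<^sub>L K' x o\<^sub>L x o\<^sub>L J x o\<^sub>L J' x))) < 1"
      by simp
  qed
  then have f_GL: "f s x \<in> GL" if "s \<in> {0..1}" "x \<in> GL" for s x
    using that by (auto simp: f_def intro: compose_GL)
  have f_eq: "f s x = x - s *\<^sub>R (K x o\<^sub>L K' x o\<^sub>L x o\<^sub>L J x o\<^sub>L J' x)" if "x \<in> GL" for s x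
    unfolding f_def g_def by (rule blinfun_eqI) (simp add: blinfun.bilinear_simps ginv_apply that)
  have f_cont: "continuous_on ({0..1} \<times> GL) (\<lambda>p. f (fst p) (snd p))"
    unfolding f_def g_def
    by (intro continuous_intros snd_cont cont) auto
  have h1: "homotopic_with_canon (\<lambda>x. True) GL GL id (f 1)"
    by (rule homotopicI[OF f_cont]) (auto simp: f_GL, simp add: f_eq)
  have f1_cont: "continuous_on GL (f 1)"
    using h1 homotopic_with_imp_continuous by blast
  have f1_GL: "x \<in> GL \<Longrightarrow> f 1 x \<in> GL" for x
    using f_GL[of 1 x] by simp
  have KfJ: "blinfun_apply (K' x) (blinfun_apply (f 1 x) (blinfun_apply (J x) v)) = 0" if "x \<in> GL" for x v
    by (simp add: f_eq that blinfun.bilinear_simps rel_apply)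
  define Y where "Y x = f 1 x o\<^sub>L J x" for x
  \<comment> \<open>The correction factor makes the left inverse of \<open>Y\<close> vanish on the range of \<open>K\<close>.\<close>
  define Y' where "Y' x = J' x o\<^sub>L ginv (f 1 x) o\<^sub>L (id_blinfun - (K x o\<^sub>L K' x))" for x
  have Y_mem: "Y x \<in> B" "Y' x \<in> B" if "x \<in> GL" for x
    using that unfolding Y_def Y'_def
    by (auto intro!: compose_mem mem GL_mem[OF f1_GL] diff_mem id_mem ginv_mem[OF f1_GL])
  have Y_pair: "isometry_pair (Y x) (Y' x) (K x) (K' x)" if "x \<in> GL" for x
    unfolding Y_def Y'_def using that
    by unfold_locales
       (auto intro!: blinfun_eqI simp: blinfun.bilinear_simps rel_apply KfJ ginv_apply f1_GL)
  have KJ_pair: "isometry_pair (K x) (K' x) (J x) (J' x)" if "x \<in> GL" for x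
    using rel[OF that] by unfold_locales auto
  \<comment> \<open>\<open>Y\<close> cannot be rotated directly into \<open>J\<close>, since their
    ranges may overlap; for \<open>x = id_blinfun\<close> they coincide. \<open>K\<close> is
    independent of both and serves as the intermediate stop.\<close>
  define z where "z t x = rot (K x) (K' x) (J x) (J' x) (t * (pi/2)) o\<^sub>L
    rot (Y x) (Y' x) (K x) (K' x) (t * (pi/2)) o\<^sub>L f 1 x" for t x
  have Y_cont: "continuous_on GL Y" "continuous_on GL Y'"
    unfolding Y_def Y'_def using f1_GL by (auto intro!: continuous_intros cont f1_cont)
  have z_GL: "z t x \<in> GL" if "x \<in> GL" for t x
    unfolding z_def using that
    by (intro compose_GL isometry_pair.rot_GL[OF KJ_pair] isometry_pair.rot_GL[OF Y_pair]
        operator_algebra_axioms mem Y_mem f1_GL)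
  have z_cont: "continuous_on ({0..1} \<times> GL) (\<lambda>p. z (fst p) (snd p))"
    unfolding z_def
    by (intro continuous_intros snd_cont cont Y_cont f1_cont) auto
  have h2: "homotopic_with_canon (\<lambda>x. True) GL GL (f 1) (z 1)"
    by (rule homotopicI[OF z_cont]) (auto simp: z_GL, simp add: z_def)
  have z1_cont: "continuous_on GL (z 1)"
    using h2 homotopic_with_imp_continuous by blast
  have zJ: "z 1 x o\<^sub>L J x = J x" if "x \<in> GL" for x
  proof -
    have "z 1 x o\<^sub>L J x = rot (K x) (K' x) (J x) (J' x) (pi/2) o\<^sub>L
        (rot (Y x) (Y' x) (K x) (K' x) (pi/2) o\<^sub>L Y x)"
      by (simp add: z_def Y_def blinfun_compose_assoc)
    then show ?thesis
      by (simp add: isometry_pair.rot_pi_half[OF Y_pair] isometry_pair.rot_pi_half[OF KJ_pair] that)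
  qed
  have zJ_apply: "blinfun_apply (z 1 x) (blinfun_apply (J x) v) = blinfun_apply (J x) v" if "x \<in> GL" for x v
    using blinfun_compose_apply_eq[OF zJ[OF that]] .
  \<comment> \<open>\<open>z 1 x\<close> is block triangular with the identity in the corner.
    \<open>N x\<close> is its remaining off-diagonal block and squares to zero, so it can be removed
    linearly without any smallness.\<close>
  define N where "N x = J x o\<^sub>L J' x o\<^sub>L z 1 x o\<^sub>L (id_blinfun - (J x o\<^sub>L J' x))" for x
  define w where "w s x = z 1 x o\<^sub>L (id_blinfun - s *\<^sub>R N x)" for s x
  have w_GL: "w s x \<in> GL" if "x \<in> GL" for s x
    unfolding w_def
  proof (intro compose_GL z_GL that id_minus_nilpotent_GL)
    show "s *\<^sub>R N x \<in> B"
      unfolding N_def using that by (intro mem_intros mem GL_mem[OF z_GL])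
    show "s *\<^sub>R N x o\<^sub>L s *\<^sub>R N x = 0"
      unfolding N_def by (rule blinfun_eqI) (simp add: blinfun.bilinear_simps rel_apply that)
  qed
  have w_cont: "continuous_on ({0..1} \<times> GL) (\<lambda>p. w (fst p) (snd p))"
    unfolding w_def N_def by (intro continuous_intros snd_cont cont z1_cont)
  have h3: "homotopic_with_canon (\<lambda>x. True) GL GL (z 1) (w 1)"
    by (rule homotopicI[OF w_cont]) (auto simp: w_GL, simp add: w_def)
  show thesis
  proof
    show "homotopic_with_canon (\<lambda>x. True) GL GL id (w 1)"
      using h1 h2 h3 homotopic_with_trans by blast
    show "w 1 x o\<^sub>L J x = J x" "J' x o\<^sub>L w 1 x = J' x" if "x \<in> GL" for x
      unfolding w_def N_def
      by (rule blinfun_eqI, simp add: blinfun.bilinear_simps rel_apply zJ_apply that)+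
  qed
qed

text \<open>\<open>S0\<close> and \<open>S1\<close> split the space into two copies of itself, and
  \<open>D_rec\<close> says that \<open>D a\<close> is the direct sum of \<open>a\<close> and
  \<open>D a\<close>. Multiplicativity of \<open>D\<close> makes \<open>D (w x)\<close>
  invertible.\<close>

theorem contractible_GL:
  fixes J J' K K' :: "('a \<Rightarrow>\<^sub>L 'a) \<Rightarrow> ('a \<Rightarrow>\<^sub>L 'a)"
    and S0 S0' S1 S1' :: "'a \<Rightarrow>\<^sub>L 'a" and D :: "('a \<Rightarrow>\<^sub>L 'a) \<Rightarrow> ('a \<Rightarrow>\<^sub>L 'a)"
  assumes cont: "continuous_on GL J" "continuous_on GL J'" "continuous_on GL K" "continuous_on GL K'"
    and mem: "\<And>x. x \<in> GL \<Longrightarrow> J x \<in> B" "\<And>x. x \<in> GL \<Longrightarrow> J' x \<in> B"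
      "\<And>x. x \<in> GL \<Longrightarrow> K x \<in> B" "\<And>x. x \<in> GL \<Longrightarrow> K' x \<in> B"
    and rel: "\<And>x. x \<in> GL \<Longrightarrow> J' x o\<^sub>L J x = id_blinfun" "\<And>x. x \<in> GL \<Longrightarrow> K' x o\<^sub>L K x = id_blinfun"
      "\<And>x. x \<in> GL \<Longrightarrow> J' x o\<^sub>L K x = 0" "\<And>x. x \<in> GL \<Longrightarrow> K' x o\<^sub>L J x = 0"
    and small: "\<And>x. x \<in> GL \<Longrightarrow> norm (ginv x o\<^sub>L (K x o\<^sub>L K' x o\<^sub>L x o\<^sub>L J x o\<^sub>L J' x)) < 1"
    and S_mem: "S0 \<in> B" "S0' \<in> B" "S1 \<in> B" "S1' \<in> B"
    and S_rel: "S0' o\<^sub>L S0 = id_blinfun" "S1' o\<^sub>L S1 = id_blinfun" "S0' o\<^sub>L S1 = 0" "S1' o\<^sub>L S0 = 0"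
    and S_sum: "(S0 o\<^sub>L S0') + (S1 o\<^sub>L S1') = id_blinfun"
    and D_mem: "\<And>a. a \<in> B \<Longrightarrow> D a \<in> B"
    and D_cont: "continuous_on B D"
    and D_id: "D id_blinfun = id_blinfun"
    and D_mult: "\<And>a b. a \<in> B \<Longrightarrow> b \<in> B \<Longrightarrow> D (a o\<^sub>L b) = D a o\<^sub>L D b"
    and D_rec: "\<And>a. a \<in> B \<Longrightarrow> D a = (S0 o\<^sub>L a o\<^sub>L S0') + (S1 o\<^sub>L D a o\<^sub>L S1')"
  shows "contractible GL"
proof -
  obtain w where hw: "homotopic_with_canon (\<lambda>x. True) GL GL id w"
    and wJ: "\<And>x. x \<in> GL \<Longrightarrow> w x o\<^sub>L J x = J x" and Jw: "\<And>x. x \<in> GL \<Longrightarrow> J' x o\<^sub>L w x = J' x"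
    by (rule homotopic_to_fixing[OF cont mem rel small]) auto
  have w_cont: "continuous_on GL w"
    using hw homotopic_with_imp_continuous by blast
  have w_GL: "x \<in> GL \<Longrightarrow> w x \<in> GL" for x
    using hw homotopic_with_imp_subset2 by blast
  note w_mem = GL_mem[OF w_GL]
  have JJ: "blinfun_apply (J' x) (blinfun_apply (J x) v) = v" if "x \<in> GL" for x v
    using blinfun_compose_apply_eq[OF rel(1)[OF that]] by simp
  note S_apply = S_rel[THEN blinfun_compose_apply_eq, simplified]
  have S_sum_apply: "blinfun_apply S0 (blinfun_apply S0' v) = v - blinfun_apply S1 (blinfun_apply S1' v)" for v
    using arg_cong[OF S_sum, of "\<lambda>a. blinfun_apply a v"]
    by (simp add: blinfun.bilinear_simps algebra_simps)
  define u where "u x = D (w x)" for x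
  have u_mem: "u x \<in> B" if "x \<in> GL" for x
    unfolding u_def by (intro D_mem w_mem that)
  have u_GL: "u x \<in> GL" if "x \<in> GL" for x
    unfolding u_def
    by (rule GL_I[of _ "D (ginv (w x))"])
       (auto intro!: D_mem w_mem that ginv_mem w_GL
          simp flip: D_mult simp: that w_mem w_GL ginv_mem ginv_left ginv_right D_id)
  have u_cont: "continuous_on GL u"
    unfolding u_def using w_mem by (intro continuous_on_compose2[OF D_cont w_cont]) auto
  \<comment> \<open>The room \<open>J\<close> is split into the parts \<open>A\<close>, \<open>F\<close> and a spare part. Since \<open>D w\<close> is \<open>w\<close> followed by a
    copy of \<open>D w\<close>, it also fills the range of \<open>C\<close>, which consists of the complement of the room,
    where \<open>w\<close> lives, of \<open>F\<close>, and of the spare part, where the identity part of \<open>w\<close> is put.\<close>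
  define A where "A x = J x o\<^sub>L S0" for x
  define A' where "A' x = S0' o\<^sub>L J' x" for x
  define F where "F x = J x o\<^sub>L S1 o\<^sub>L S0" for x
  define F' where "F' x = S0' o\<^sub>L S1' o\<^sub>L J' x" for x
  define C where "C x = ((id_blinfun - (J x o\<^sub>L J' x)) o\<^sub>L S0')
    + (J x o\<^sub>L S1 o\<^sub>L S1 o\<^sub>L J' x o\<^sub>L S0') + (J x o\<^sub>L S1 o\<^sub>L S0 o\<^sub>L S1')" for x
  define C' where "C' x = (S0 o\<^sub>L (id_blinfun - (J x o\<^sub>L J' x)))
    + (S0 o\<^sub>L J x o\<^sub>L S1' o\<^sub>L S1' o\<^sub>L J' x) + (S1 o\<^sub>L S0' o\<^sub>L S1' o\<^sub>L J' x)" for x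
  note defs = A_def A'_def F_def F'_def C_def C'_def
  have ACF_mem: "A x \<in> B" "A' x \<in> B" "F x \<in> B" "F' x \<in> B" "C x \<in> B" "C' x \<in> B" if "x \<in> GL" for x
    unfolding defs by (intro mem_intros mem that S_mem)+
  have ACF_cont: "continuous_on GL A" "continuous_on GL A'" "continuous_on GL F" "continuous_on GL F'"
     "continuous_on GL C" "continuous_on GL C'"
    unfolding defs by (intro continuous_intros cont)+
  have AF: "isometry_pair (A x) (A' x) (F x) (F' x)" if "x \<in> GL" for x
    unfolding defs
    by unfold_locales (auto intro!: blinfun_eqI simp: blinfun.bilinear_simps JJ[OF that] S_apply)
  have CA: "isometry_pair (C x) (C' x) (A x) (A' x)" if "x \<in> GL" for x
    unfolding defs
    by unfold_locales
       (auto intro!: blinfun_eqI simp: blinfun.bilinear_simps JJ[OF that] S_apply S_sum_apply)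
  have snd_cont: "continuous_on (T \<times> GL) (\<lambda>p. f (snd p))"
    if "continuous_on GL f" for f :: "('a \<Rightarrow>\<^sub>L 'a) \<Rightarrow> 'a \<Rightarrow>\<^sub>L 'a" and T :: "real set"
    by (rule continuous_on_compose2[OF that]) (auto intro!: continuous_intros)
  \<comment> \<open>The identity factor, \<open>u\<close> on \<open>A\<close> times its inverse, is
    inserted behind \<open>w\<close>; \<open>p\<close> moves the copy of \<open>u\<close> from
    \<open>A\<close> to \<open>F\<close>. There \<open>w\<close> absorbs it into the copy of
    \<open>u\<close> on \<open>C\<close>, and \<open>q\<close> moves that copy to \<open>A\<close>,
    where it cancels the inverse.\<close>
  define p where "p t x = w x o\<^sub>L extend (A x) (A' x) (ginv (u x)) o\<^sub>L
     (rot (A x) (A' x) (F x) (F' x) (t * (pi/2)) o\<^sub>L extend (A x) (A' x) (u x) o\<^sub>L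
      rot (A x) (A' x) (F x) (F' x) (- (t * (pi/2))))" for t x
  define q where "q t x = rot (C x) (C' x) (A x) (A' x) (t * (pi/2)) o\<^sub>L extend (C x) (C' x) (u x) o\<^sub>L
      rot (C x) (C' x) (A x) (A' x) (- (t * (pi/2))) o\<^sub>L extend (A x) (A' x) (ginv (u x))" for t x
  have p_GL: "p t x \<in> GL" if "x \<in> GL" for t x
    unfolding p_def
    by (intro compose_GL w_GL extend_GL isometry_pair.rot_GL[OF AF] isometry_pair.rel[OF AF]
        ginv_in_GL u_GL that operator_algebra_axioms ACF_mem)
  have q_GL: "q t x \<in> GL" if "x \<in> GL" for t x
    unfolding q_def
    by (intro compose_GL w_GL extend_GL isometry_pair.rot_GL[OF CA] isometry_pair.rel[OF CA]
        ginv_in_GL u_GL that operator_algebra_axioms ACF_mem)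
  have p_cont: "continuous_on ({0..1} \<times> GL) (\<lambda>y. p (fst y) (snd y))"
    unfolding p_def by (intro continuous_intros snd_cont ACF_cont w_cont u_cont) (auto simp: u_GL)
  have q_cont: "continuous_on ({0..1} \<times> GL) (\<lambda>y. q (fst y) (snd y))"
    unfolding q_def by (intro continuous_intros snd_cont ACF_cont w_cont u_cont) (auto simp: u_GL)
  have p0: "p 0 x = w x" if "x \<in> GL" for x
    by (simp add: p_def that u_GL extend_id blinfun_compose_assoc ginv_left
        extend_compose[OF isometry_pair.rel(1)[OF AF]])
  \<comment> \<open>By \<open>u_S\<close>, \<open>u\<close> acts as \<open>w\<close> on the half
    \<open>S0\<close> and as \<open>u\<close> on the half \<open>S1\<close>. \<open>C\<close>
    carries \<open>S1\<close> to \<open>F\<close>; of \<open>S0\<close> it keeps the complement of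
    the room in place and sends the room to the spare part, where both sides are the
    identity.\<close>
  have wF: "w x o\<^sub>L extend (F x) (F' x) (u x) = extend (C x) (C' x) (u x)" if "x \<in> GL" for x
  proof (rule blinfun_eqI)
    fix v
    have u_rec: "blinfun_apply (u x) y = blinfun_apply S0 (blinfun_apply (w x) (blinfun_apply S0' y))
        + blinfun_apply S1 (blinfun_apply (u x) (blinfun_apply S1' y))" for y
      using arg_cong[OF D_rec[OF w_mem[OF that]], of "\<lambda>a. blinfun_apply a y"]
      by (simp add: u_def blinfun.bilinear_simps)
    have u_S: "blinfun_apply S0' (blinfun_apply (u x) y) = blinfun_apply (w x) (blinfun_apply S0' y)"
      "blinfun_apply S1' (blinfun_apply (u x) y) = blinfun_apply (u x) (blinfun_apply S1' y)" for y
      by (subst u_rec, simp add: blinfun.bilinear_simps S_apply)+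
    show "blinfun_apply (w x o\<^sub>L extend (F x) (F' x) (u x)) v = blinfun_apply (extend (C x) (C' x) (u x)) v"
      unfolding defs extend_def
      by (simp add: blinfun.bilinear_simps JJ[OF that] S_apply u_S
          blinfun_compose_apply_eq[OF wJ[OF that]] blinfun_compose_apply_eq[OF Jw[OF that]])
  qed
  have commute: "extend (A x) (A' x) a o\<^sub>L extend (F x) (F' x) b =
      extend (F x) (F' x) b o\<^sub>L extend (A x) (A' x) a" if "x \<in> GL" for a b x
    unfolding extend_def
    by (rule blinfun_eqI) (simp add: blinfun.bilinear_simps isometry_pair.rel_apply[OF AF[OF that]])
  have p1: "p 1 x = q 0 x" if "x \<in> GL" for x
  proof -
    have "p 1 x = w x o\<^sub>L (extend (A x) (A' x) (ginv (u x)) o\<^sub>L extend (F x) (F' x) (u x))"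
      by (simp add: p_def isometry_pair.rot_extend[OF AF[OF that]])
         (simp add: blinfun_compose_assoc)
    also have "\<dots> = w x o\<^sub>L extend (F x) (F' x) (u x) o\<^sub>L extend (A x) (A' x) (ginv (u x))"
      by (simp add: commute[OF that] blinfun_compose_assoc)
    finally show ?thesis
      by (simp add: wF[OF that] q_def)
  qed
  have q1: "q 1 x = id_blinfun" if "x \<in> GL" for x
    by (simp add: q_def isometry_pair.rot_extend[OF CA[OF that]]
        extend_compose[OF isometry_pair.rel(1)[OF AF[OF that]]] ginv_right u_GL that extend_id)
  have "homotopic_with_canon (\<lambda>x. True) GL GL w (q 0)"
    by (rule homotopicI[OF p_cont]) (auto simp: p_GL p0 p1)
  moreover have "homotopic_with_canon (\<lambda>x. True) GL GL (q 0) (\<lambda>x. id_blinfun)"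
    by (rule homotopicI[OF q_cont]) (auto simp: q_GL q1)
  ultimately show ?thesis
    unfolding contractible_def using hw homotopic_with_trans by blast
qed

end

section \<open>Weights on the barycentric subdivision\<close>

lemma SUP_le_SUP_add:
  fixes f g :: "'i \<Rightarrow> real"
  assumes "\<And>i. f i \<le> g i + d" "\<And>i. g i \<le> M"
  shows "(SUP i. f i) \<le> (SUP i. g i) + d"
proof (rule cSUP_least)
  fix i
  have "g i \<le> (SUP i. g i)"
    using assms(2) by (intro cSUP_upper) (auto intro!: bdd_aboveI[of _ M])
  then show "f i \<le> (SUP i. g i) + d"
    using assms(1)[of i] by linarith
qed simp

lemma INF_le_INF_add:
  fixes f g :: "'i \<Rightarrow> real"
  assumes "F \<noteq> {}" "\<And>i. f i \<le> g i + d" "\<And>i. M \<le> f i"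
  shows "(INF i\<in>F. f i) \<le> (INF i\<in>F. g i) + d"
proof -
  have "(INF i\<in>F. f i) - d \<le> (INF i\<in>F. g i)"
  proof (rule cINF_greatest[OF assms(1)])
    fix i assume "i \<in> F"
    then have "(INF i\<in>F. f i) \<le> f i"
      using assms(3) by (intro cINF_lower) (auto intro!: bdd_belowI[of _ M])
    then show "(INF i\<in>F. f i) - d \<le> g i"
      using assms(2)[of i] by linarith
  qed
  then show ?thesis
    by linarith
qed

text \<open>The rounded binary logarithm turns doubling into a strict increase, so it injects the
  indices into a bounded interval of integers.\<close>

lemma finite_if_doubling:
  fixes val :: "'i \<Rightarrow> real"
  assumes tot: "\<And>i j. i \<in> A \<Longrightarrow> j \<in> A \<Longrightarrow> i \<noteq> j \<Longrightarrow> lt i j \<or> lt j i"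
    and double: "\<And>i j. i \<in> A \<Longrightarrow> j \<in> A \<Longrightarrow> lt i j \<Longrightarrow> 2 * val i \<le> val j"
    and "0 < c" "\<And>i. i \<in> A \<Longrightarrow> c \<le> val i" "\<And>i. i \<in> A \<Longrightarrow> val i \<le> 1"
  shows "finite A"
proof -
  let ?h = "\<lambda>i. \<lfloor>log 2 (val i)\<rfloor>"
  have pos: "val i > 0" if "i \<in> A" for i
    using assms(3,4) that by force
  have step: "?h i < ?h j" if "i \<in> A" "j \<in> A" "lt i j" for i j
  proof -
    have "log 2 (2 * val i) \<le> log 2 (val j)"
      using double[OF that] pos that by (subst log_le_cancel_iff) auto
    then have "log 2 (val i) + 1 \<le> log 2 (val j)"
      using pos[OF that(1)] by (simp add: log_mult)
    then show ?thesis
      by linarith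
  qed
  have "inj_on ?h A"
    by (rule inj_onI) (metis tot step order_less_irrefl)
  moreover have "?h ` A \<subseteq> {\<lfloor>log 2 c\<rfloor>..0}"
  proof (rule image_subsetI)
    fix i assume i: "i \<in> A"
    have "log 2 c \<le> log 2 (val i)" "log 2 (val i) \<le> log 2 1"
      using assms(3,4,5) pos i by auto
    then show "\<lfloor>log 2 (val i)\<rfloor> \<in> {\<lfloor>log 2 c\<rfloor>..0}"
      using floor_mono[of "log 2 c"] by (simp add: le_floor_iff floor_le_iff)
  qed
  ultimately show ?thesis
    by (meson finite_atLeastAtMost_int finite_imageD finite_subset)
qed

text \<open>Infinitely many bumps may be positive at one point. The Lipschitz constant common to all
  indices makes their suprema continuous, and local finiteness is produced from it below.\<close>

locale bump_family =
  fixes X :: "'m::metric_space set" and b :: "'i \<Rightarrow> 'm \<Rightarrow> real"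
  assumes b_nonneg: "x \<in> X \<Longrightarrow> 0 \<le> b i x" and b_le_1: "x \<in> X \<Longrightarrow> b i x \<le> 1"
    and b_lipschitz: "x \<in> X \<Longrightarrow> y \<in> X \<Longrightarrow> b i x \<le> b i y + dist x y"
    and b_pos: "x \<in> X \<Longrightarrow> \<exists>i. b i x > 0"
begin

definition order :: "'i rel" where
  "order = (SOME r. Well_order r \<and> Field r = UNIV)"

definition prec :: "'i \<Rightarrow> 'i \<Rightarrow> bool" where
  "prec i j \<longleftrightarrow> (i, j) \<in> order - Id"

lemma order: "Well_order order" "Field order = UNIV"
  using someI_ex[OF well_ordering] unfolding order_def by auto

lemma prec_total: "i \<noteq> j \<Longrightarrow> prec i j \<or> prec j i"
  using order unfolding well_order_on_def linear_order_on_def total_on_def prec_def by auto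

lemma prec_minimal:
  assumes "P i"
  obtains j where "P j" "\<And>k. prec k j \<Longrightarrow> \<not> P k"
proof -
  have "wf (order - Id)"
    using order by (simp add: well_order_on_def)
  then show thesis
    using assms that wfE_min[of "order - Id" i "Collect P"] unfolding prec_def
    by (metis mem_Collect_eq)
qed

text \<open>The default 0 is harmless, as bumps are nonnegative, and it keeps the supremum over a
  nonempty family even at the least index.\<close>

definition below where "below i x = (SUP j. if prec j i then b j x else 0)"

text \<open>
  Along indices that are active at a common point the bumps at least double, so that only finitely
  many of them are active.
\<close>

definition fresh where "fresh i x = max 0 (b i x - 2 * below i x)"

definition top_fresh where "top_fresh x = (SUP i. fresh i x)"

text \<open>Cutting at half of the supremum gives the surviving values of \<open>fresh\<close> a
  locally uniform positive lower bound, as the doubling argument requires. Since the supremum is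
  positive, some index survives.\<close>

definition coord where "coord i x = max 0 (fresh i x - top_fresh x / 2)"

text \<open>
  The open sets on which the weight of a finite set of indices does not vanish are the open stars
  of the barycentric subdivision of the nerve.
\<close>

definition weight where
  "weight F x = (if F = {} then 0 else
    max 0 ((INF i\<in>F. coord i x) - (SUP i. if i \<in> F then 0 else coord i x)))"

context
  fixes x assumes x: "x \<in> X"
begin

lemma below_upper: "prec j i \<Longrightarrow> b j x \<le> below i x"
  unfolding below_def
  by (rule cSUP_upper2[of _ _ j]) (auto intro!: bdd_aboveI[of _ 1] simp: b_le_1 x)

lemma below_nonneg: "0 \<le> below i x"
  unfolding below_def
  by (rule cSUP_upper2[of _ _ i]) (auto intro!: bdd_aboveI[of _ 1] simp: b_le_1 b_nonneg x)

lemma fresh_bounds: "0 \<le> fresh i x" "fresh i x \<le> b i x"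
  using below_nonneg[of i] b_nonneg[OF x, of i] by (auto simp: fresh_def)

lemma fresh_le_1: "fresh i x \<le> 1"
  using fresh_bounds b_le_1[OF x] order_trans by blast

lemma top_fresh_upper: "fresh i x \<le> top_fresh x"
  unfolding top_fresh_def by (rule cSUP_upper) (auto intro!: bdd_aboveI[of _ 1] simp: fresh_le_1)

text \<open>At the least index with a positive bump nothing is subtracted. This is what the
  well-order is for.\<close>

lemma top_fresh_pos: "0 < top_fresh x"
proof -
  obtain i where i: "b i x > 0" "\<And>k. prec k i \<Longrightarrow> \<not> b k x > 0"
    using b_pos[OF x] prec_minimal[of "\<lambda>i. b i x > 0"] by metis
  have "below i x \<le> 0"
    unfolding below_def using i(2) by (intro cSUP_least) (auto simp: not_less)
  then have "fresh i x > 0"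
    using i(1) by (simp add: fresh_def)
  then show ?thesis
    using top_fresh_upper[of i] by linarith
qed

lemma coord_bounds: "0 \<le> coord i x" "coord i x \<le> fresh i x" "coord i x \<le> 1"
  using top_fresh_pos fresh_le_1[of i] fresh_bounds(1)[of i] by (auto simp: coord_def)

lemma weight_posD:
  assumes "weight F x > 0"
  shows "F \<noteq> {}" "i \<in> F \<Longrightarrow> coord i x > 0" "i \<in> F \<Longrightarrow> j \<notin> F \<Longrightarrow> coord j x < coord i x"
proof -
  show ne: "F \<noteq> {}"
    using assms by (auto simp: weight_def)
  have less: "(SUP i. if i \<in> F then 0 else coord i x) < (INF i\<in>F. coord i x)"
    using assms ne by (simp add: weight_def split: if_splits)
  have upper: "(if j \<in> F then 0 else coord j x) \<le> (SUP i. if i \<in> F then 0 else coord i x)" for j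
    by (rule cSUP_upper) (auto intro!: bdd_aboveI[of _ 1] simp: coord_bounds)
  have lower: "(INF i\<in>F. coord i x) \<le> coord i x" if "i \<in> F" for i
    using that by (intro cINF_lower) (auto intro!: bdd_belowI[of _ 0] simp: coord_bounds)
  show "coord i x > 0" if "i \<in> F"
    using upper[of i] less lower[OF that] that by simp
  show "coord j x < coord i x" if "i \<in> F" "j \<notin> F"
    using upper[of j] less lower[OF that(1)] that by simp
qed

lemma weight_nonneg: "0 \<le> weight F x"
  by (simp add: weight_def)

text \<open>A set of positive weight is a superlevel set of the coordinates, and superlevel sets are
  nested.\<close>

lemma weight_chain:
  assumes "weight F x > 0" "weight G x > 0"
  shows "F \<subseteq> G \<or> G \<subseteq> F"
  using weight_posD(3)[OF assms(1)] weight_posD(3)[OF assms(2)] by (meson less_asym subsetI)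

lemma weight_pos_bump: "weight F x > 0 \<Longrightarrow> i \<in> F \<Longrightarrow> b i x > 0"
  using weight_posD(2)[of F i] coord_bounds(2)[of i] fresh_bounds(2)[of i] by linarith

end

context
  fixes x y assumes x: "x \<in> X" and y: "y \<in> X"
begin

lemma below_lipschitz: "below i x \<le> below i y + dist x y"
  unfolding below_def
  by (rule SUP_le_SUP_add[of _ _ _ 1]) (auto simp: b_lipschitz x y b_le_1)

end

text \<open>The constants add up: 1 + 2 here, 3 + 3/2, rounded up to 5, for \<open>coord\<close>,
  and 5 + 5 for \<open>weight\<close>. They have to be independent of the index to pass through
  suprema and infima.\<close>

lemma fresh_lipschitz: "x \<in> X \<Longrightarrow> y \<in> X \<Longrightarrow> fresh i x \<le> fresh i y + 3 * dist x y"
  using b_lipschitz[of x y i] below_lipschitz[of y x i] zero_le_dist[of x y] dist_commute[of x y]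
  unfolding fresh_def by linarith

lemma top_fresh_lipschitz: "x \<in> X \<Longrightarrow> y \<in> X \<Longrightarrow> top_fresh x \<le> top_fresh y + 3 * dist x y"
  unfolding top_fresh_def by (rule SUP_le_SUP_add[of _ _ _ 1]) (auto simp: fresh_lipschitz fresh_le_1)

lemma coord_lipschitz: "x \<in> X \<Longrightarrow> y \<in> X \<Longrightarrow> coord i x \<le> coord i y + 5 * dist x y"
  using fresh_lipschitz[of x y i] top_fresh_lipschitz[of y x] zero_le_dist[of x y] dist_commute[of x y]
  unfolding coord_def by linarith

lemma weight_lipschitz:
  assumes "x \<in> X" "y \<in> X"
  shows "weight F x \<le> weight F y + 10 * dist x y"
proof (cases "F = {}")
  case False
  let ?S = "\<lambda>x. SUP i. if i \<in> F then 0 else coord i x"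
  let ?I = "\<lambda>x. INF i\<in>F. coord i x"
  have 1: "?I x \<le> ?I y + 5 * dist x y"
    by (rule INF_le_INF_add[of _ _ _ _ 0]) (use False assms in \<open>auto simp: coord_lipschitz coord_bounds\<close>)
  have 2: "?S y \<le> ?S x + 5 * dist x y"
    by (rule SUP_le_SUP_add[of _ _ _ 1])
       (use coord_lipschitz[of y x] assms in \<open>auto simp: coord_bounds dist_commute\<close>)
  have "max 0 (?I x - ?S x) \<le> max 0 (?I y - ?S y) + 10 * dist x y"
    using 1 2 zero_le_dist[of x y] by linarith
  then show ?thesis
    using False by (simp add: weight_def)
qed (simp add: weight_def)

lemma continuous_on_weight: "continuous_on X (weight F)"
proof (rule lipschitz_on_continuous_on[of 10], rule lipschitz_onI)
  fix x y assume "x \<in> X" "y \<in> X"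
  then show "dist (weight F x) (weight F y) \<le> 10 * dist x y"
    using weight_lipschitz[of x y F] weight_lipschitz[of y x F]
    by (simp add: dist_real_def abs_le_iff dist_commute)
qed simp

lemma active_locally_finite:
  assumes x: "x \<in> X"
  shows "\<exists>d>0. finite {i. \<exists>y\<in>X. dist x y < d \<and> coord i y > 0}"
proof -
  \<comment> \<open>On the ball of radius \<open>d = c / 4\<close> the value of
    \<open>top_fresh\<close> stays at least \<open>4 * c - 3 * d\<close>, half of which exceeds
    \<open>c\<close>. Each index has its own witness point \<open>p i\<close>; comparing a bump at
    two of these, at distance at most \<open>2 * d\<close>, costs \<open>4 * d = c\<close> after
    doubling, which is the surplus in \<open>bump\<close>.\<close>
  define c where "c = top_fresh x / 4"
  define d where "d = c / 4"
  have "c > 0" "d > 0"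
    using top_fresh_pos[OF x] by (auto simp: c_def d_def)
  define A where "A = {i. \<exists>y\<in>X. dist x y < d \<and> coord i y > 0}"
  define p where "p i = (SOME y. y \<in> X \<and> dist x y < d \<and> coord i y > 0)" for i
  have p: "p i \<in> X" "dist x (p i) < d" "coord i (p i) > 0" if "i \<in> A" for i
  proof -
    have "\<exists>y. y \<in> X \<and> dist x y < d \<and> coord i y > 0"
      using that by (auto simp: A_def)
    from someI_ex[OF this] show "p i \<in> X" "dist x (p i) < d" "coord i (p i) > 0"
      unfolding p_def by auto
  qed
  have fresh: "fresh i (p i) > c" if "i \<in> A" for i
    using p[OF that] top_fresh_lipschitz[OF x p(1)[OF that]] \<open>c > 0\<close>
    unfolding coord_def c_def d_def by (auto simp: max_def split: if_splits)
  have bump: "b i (p i) > c + 2 * below i (p i)" if "i \<in> A" for i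
    using fresh[OF that] \<open>c > 0\<close> by (auto simp: fresh_def max_def split: if_splits)
  have "finite A"
  proof (rule finite_if_doubling)
    show "2 * b i (p i) \<le> b j (p j)" if "i \<in> A" "j \<in> A" "prec i j" for i j
    proof -
      have "b i (p i) \<le> b i (p j) + dist (p i) (p j)"
        using that p by (intro b_lipschitz) auto
      moreover have "dist (p i) (p j) \<le> 2 * d"
        using p(2)[OF that(1)] p(2)[OF that(2)] dist_triangle3[of "p i" "p j" x] by linarith
      ultimately show ?thesis
        using bump[OF that(2)] below_upper[OF p(1)[OF that(2)] that(3)] unfolding d_def by linarith
    qed
    show "c \<le> b i (p i)" if "i \<in> A" for i
      using bump[OF that] below_nonneg[OF p(1)[OF that], of i] by linarith
  qed (use p b_le_1 \<open>c > 0\<close> prec_total in auto)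
  then show ?thesis
    using \<open>d > 0\<close> unfolding A_def by blast
qed

lemma weight_locally_finite:
  assumes x: "x \<in> X"
  shows "\<exists>d>0. finite {F. \<exists>y\<in>X. dist x y < d \<and> weight F y \<noteq> 0}"
proof -
  obtain d where d: "d > 0" "finite {i. \<exists>y\<in>X. dist x y < d \<and> coord i y > 0}"
    using active_locally_finite[OF x] by blast
  have "{F. \<exists>y\<in>X. dist x y < d \<and> weight F y \<noteq> 0} \<subseteq> Pow {i. \<exists>y\<in>X. dist x y < d \<and> coord i y > 0}"
    using weight_nonneg weight_posD(2) by (fastforce simp: less_le)
  then show ?thesis
    using d finite_subset by blast
qed

lemma finite_active: "x \<in> X \<Longrightarrow> finite {i. coord i x > 0}"
proof -
  assume x: "x \<in> X"
  obtain d where d: "d > 0" "finite {i. \<exists>y\<in>X. dist x y < d \<and> coord i y > 0}"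
    using active_locally_finite[OF x] by blast
  show "finite {i. coord i x > 0}"
    by (rule finite_subset[OF _ d(2)]) (use d x in \<open>auto intro!: bexI[of _ x]\<close>)
qed

lemma finite_weights: "x \<in> X \<Longrightarrow> finite {F. weight F x \<noteq> 0}"
proof -
  assume x: "x \<in> X"
  obtain d where d: "d > 0" "finite {F. \<exists>y\<in>X. dist x y < d \<and> weight F y \<noteq> 0}"
    using weight_locally_finite[OF x] by blast
  show "finite {F. weight F x \<noteq> 0}"
    by (rule finite_subset[OF _ d(2)]) (use d x in \<open>auto intro!: bexI[of _ x]\<close>)
qed

lemma weight_pos_finite:
  assumes "x \<in> X" "weight F x > 0"
  shows "finite F"
  by (rule finite_subset[OF _ finite_active[OF assms(1)]]) (use weight_posD(2)[OF assms] in auto)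

lemma weight_pos_ex:
  assumes x: "x \<in> X"
  shows "\<exists>F. weight F x > 0"
proof
  \<comment> \<open>The largest member of the chain. It is finite, so the infimum over it is
    attained and positive.\<close>
  let ?F = "{i. coord i x > 0}"
  have "\<exists>i\<in>UNIV. top_fresh x / 2 < fresh i x"
    using top_fresh_pos[OF x] unfolding top_fresh_def
    by (subst less_cSUP_iff[symmetric]) (auto intro!: bdd_aboveI[of _ 1] simp: fresh_le_1 x)
  then obtain i where "top_fresh x / 2 < fresh i x"
    by blast
  then have "coord i x > 0"
    by (simp add: coord_def less_max_iff_disj)
  then have ne: "?F \<noteq> {}"
    by blast
  have "(INF i\<in>?F. coord i x) = Min ((\<lambda>i. coord i x) ` ?F)"
    using finite_active[OF x] ne by (intro cInf_eq_Min) auto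
  also have "\<dots> \<in> (\<lambda>i. coord i x) ` ?F"
    using finite_active[OF x] ne by (intro Min_in) auto
  finally have 1: "(INF i\<in>?F. coord i x) > 0"
    by auto
  have "(SUP i. if i \<in> ?F then 0 else coord i x) \<le> 0"
    by (rule cSUP_least) auto
  with 1 show "weight ?F x > 0"
    using ne by (simp add: weight_def)
qed

abbreviation "active x \<equiv> {F. weight F x \<noteq> 0}"

text \<open>The index set of the sum varies with the point, but near each point it lies in one fixed
  finite set, and the added terms vanish.\<close>

lemma continuous_on_sum_active:
  fixes h :: "'i set \<Rightarrow> 'm \<Rightarrow> 'v::real_normed_vector"
  assumes "\<And>F. continuous_on X (h F)" "\<And>F x. weight F x = 0 \<Longrightarrow> h F x = 0"
  shows "continuous_on X (\<lambda>x. \<Sum>F\<in>active x. h F x)"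
  unfolding continuous_on_eq_continuous_within
proof
  fix x assume x: "x \<in> X"
  obtain d where d: "d > 0" "finite {F. \<exists>y\<in>X. dist x y < d \<and> weight F y \<noteq> 0}" (is "finite ?A")
    using weight_locally_finite[OF x] by blast
  have "continuous (at x within X) (\<lambda>y. \<Sum>F\<in>?A. h F y)"
    using assms(1) x by (intro continuous_sum) (auto simp: continuous_on_eq_continuous_within)
  moreover have "(\<Sum>F\<in>?A. h F y) = (\<Sum>F\<in>active y. h F y)" if "y \<in> X" "dist y x < d" for y
    using d(2) that by (intro sum.mono_neutral_right) (auto simp: assms(2) dist_commute)
  ultimately show "continuous (at x within X) (\<lambda>x. \<Sum>F\<in>active x. h F x)"
    by (rule continuous_transform_within[OF _ d(1) x])
qed

definition total where "total x = (\<Sum>F\<in>active x. (weight F x)\<^sup>2)"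

lemma total_pos:
  assumes "x \<in> X"
  shows "total x > 0"
proof -
  obtain F where "weight F x > 0"
    using weight_pos_ex[OF assms] by blast
  then show ?thesis
    unfolding total_def by (intro sum_pos2[OF finite_weights[OF assms], of F]) auto
qed

definition mix :: "('i set \<Rightarrow> 'v::real_normed_vector) \<Rightarrow> 'm \<Rightarrow> 'v" where
  "mix g x = (1 / sqrt (total x)) *\<^sub>R (\<Sum>F\<in>active x. weight F x *\<^sub>R g F)"

lemma continuous_on_mix: "continuous_on X (mix g)"
proof -
  have "continuous_on X total"
    unfolding total_def[abs_def]
    by (intro continuous_on_sum_active continuous_on_power continuous_on_weight) simp
  moreover have "continuous_on X (\<lambda>x. \<Sum>F\<in>active x. weight F x *\<^sub>R g F)"
    by (intro continuous_on_sum_active continuous_on_scaleR continuous_on_weight continuous_on_const) simp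
  ultimately show ?thesis
    unfolding mix_def[abs_def] using total_pos by (intro continuous_intros) force+
qed

text \<open>Cross terms vanish and the squares of the coefficients sum to 1. With \<open>r\<close>
  the identity this makes the mixtures isometries; with \<open>r = 0\<close> it transfers vanishing
  products to them.\<close>

lemma bilinear_mix:
  assumes "bounded_bilinear m" "x \<in> X"
    and "\<And>F G. F \<in> active x \<Longrightarrow> G \<in> active x \<Longrightarrow> m (g F) (h G) = (if F = G then r else 0)"
  shows "m (mix g x) (mix h x) = r"
proof -
  interpret bounded_bilinear m
    by fact
  note fin = finite_weights[OF assms(2)]
  have "m (mix g x) (mix h x) = (1 / total x) *\<^sub>R
      (\<Sum>G\<in>active x. \<Sum>F\<in>active x. (weight G x * weight F x) *\<^sub>R m (g F) (h G))"
    using total_pos[OF assms(2)] unfolding mix_def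
    by (simp add: scaleR_left scaleR_right sum_left sum_right scaleR_sum_right mult_ac
        flip: real_sqrt_mult)
  also have "(\<Sum>G\<in>active x. \<Sum>F\<in>active x. (weight G x * weight F x) *\<^sub>R m (g F) (h G)) =
      (\<Sum>G\<in>active x. \<Sum>F\<in>active x. if F = G then (weight G x)\<^sup>2 *\<^sub>R r else 0)"
    by (intro sum.cong refl) (auto simp: assms(3) power2_eq_square)
  also have "\<dots> = total x *\<^sub>R r"
    using fin by (simp add: total_def scaleR_sum_left)
  finally show ?thesis
    using total_pos[OF assms(2)] by simp
qed

text \<open>In a finite chain of finite sets a member of least cardinality is contained in all
  others.\<close>

lemma active_least:
  assumes x: "x \<in> X"
  obtains F where "F \<in> active x" "F \<noteq> {}" "\<And>G. G \<in> active x \<Longrightarrow> F \<subseteq> G"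
proof -
  have pos: "weight G x > 0" if "G \<in> active x" for G
    using that weight_nonneg[OF x, of G] by simp
  have "active x \<noteq> {}"
    using weight_pos_ex[OF x] by force
  then obtain F where F: "F \<in> active x" "\<And>G. G \<in> active x \<Longrightarrow> card F \<le> card G"
    using arg_min_if_finite[OF finite_weights[OF x], of card] by (metis not_le_imp_less)
  have "F \<subseteq> G" if "G \<in> active x" for G
    using weight_chain[OF x pos[OF F(1)] pos[OF that]] F(2)[OF that]
      weight_pos_finite[OF x pos[OF F(1)]] card_seteq by blast
  then show thesis
    using that F(1) weight_posD(1)[OF x pos[OF F(1)]] by blast
qed

end

section \<open>Independent sequences in sparse relations\<close>

text \<open>The bound is one-sided; conditions on rows and columns become sparsity of the support
  and of its converse.\<close>

definition sparse :: "nat \<Rightarrow> (nat \<times> nat) set \<Rightarrow> bool" where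
  "sparse k R \<longleftrightarrow> (\<forall>i. finite (R `` {i}) \<and> card (R `` {i}) \<le> k)"

lemma sparse_mono:
  assumes "R \<subseteq> R'" "sparse k R'" "k \<le> k'"
  shows "sparse k' R"
  unfolding sparse_def
proof
  fix i
  have "R `` {i} \<subseteq> R' `` {i}"
    using assms(1) by blast
  then show "finite (R `` {i}) \<and> card (R `` {i}) \<le> k'"
    using assms(2,3) unfolding sparse_def by (meson card_mono finite_subset order_trans)
qed

lemma sparse_Un:
  assumes "sparse k R" "sparse l R'"
  shows "sparse (k + l) (R \<union> R')"
  unfolding sparse_def
proof
  fix i
  show "finite ((R \<union> R') `` {i}) \<and> card ((R \<union> R') `` {i}) \<le> k + l"
    using assms unfolding sparse_def Un_Image
    by (meson add_mono card_Un_le finite_UnI order_trans)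
qed

lemma sparse_comp:
  assumes "sparse k R" "sparse l R'"
  shows "sparse (k * l) (R O R')"
  unfolding sparse_def
proof
  fix i
  have eq: "(R O R') `` {i} = (\<Union>j\<in>R `` {i}. R' `` {j})"
    by blast
  have "card (\<Union>j\<in>R `` {i}. R' `` {j}) \<le> (\<Sum>j\<in>R `` {i}. card (R' `` {j}))"
    using assms(1) unfolding sparse_def by (intro card_UN_le) blast
  also have "\<dots> \<le> card (R `` {i}) * l"
    using assms(2) unfolding sparse_def by (intro order_trans[OF sum_bounded_above[of _ _ l]]) auto
  also have "\<dots> \<le> k * l"
    using assms(1) unfolding sparse_def by simp
  finally show "finite ((R O R') `` {i}) \<and> card ((R O R') `` {i}) \<le> k * l"
    using assms unfolding eq sparse_def by blast
qed

lemma sparse_Id: "sparse 1 Id"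
  by (simp add: sparse_def)


text \<open>Having an infinite complement is not stable under finite unions; thinness is stable and
  still forces an infinite complement. The windows match sequences that grow at least by
  doubling.\<close>

definition thin :: "nat set \<Rightarrow> bool" where
  "thin M \<longleftrightarrow> (\<exists>C. \<forall>m. card (M \<inter> {m..2 * m}) \<le> C)"

lemma thin_empty: "thin {}"
  by (simp add: thin_def)

lemma thin_Un:
  assumes "thin M" "thin N"
  shows "thin (M \<union> N)"
proof -
  obtain C D where "\<And>m. card (M \<inter> {m..2 * m}) \<le> C" "\<And>m. card (N \<inter> {m..2 * m}) \<le> D"
    using assms unfolding thin_def by blast
  then have "card ((M \<union> N) \<inter> {m..2 * m}) \<le> C + D" for m
    unfolding Int_Un_distrib2 by (meson add_mono card_Un_le order_trans)
  then show ?thesis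
    unfolding thin_def by blast
qed

lemma thin_UN: "finite I \<Longrightarrow> (\<And>i. i \<in> I \<Longrightarrow> thin (M i)) \<Longrightarrow> thin (\<Union>i\<in>I. M i)"
  by (induction I rule: finite_induct) (auto simp: thin_empty thin_Un)

lemma infinite_Compl_thin:
  assumes "thin M"
  shows "infinite (- M)"
proof
  assume "finite (- M)"
  then obtain N where N: "\<And>n. n \<in> - M \<Longrightarrow> n < N"
    by (auto simp: finite_nat_set_iff_bounded)
  obtain C where C: "\<And>m. card (M \<inter> {m..2 * m}) \<le> C"
    using assms unfolding thin_def by blast
  \<comment> \<open>The window lies beyond all exceptions and has \<open>?m + 1\<close> members,
    more than \<open>C\<close>.\<close>
  let ?m = "max N C"
  have "{?m..2 * ?m} \<subseteq> M"
  proof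
    fix n assume "n \<in> {?m..2 * ?m}"
    then show "n \<in> M"
      using N[of n] by (cases "n \<in> M") auto
  qed
  then have "M \<inter> {?m..2 * ?m} = {?m..2 * ?m}"
    by blast
  then have "?m + 1 \<le> C"
    using C[of ?m] by simp
  then show False
    by simp
qed

lemma sparse_independent_sequence:
  assumes R: "sparse D R" "sym R" "Id \<subseteq> R" and Z: "thin Z"
  obtains r :: "nat \<Rightarrow> nat" where "inj r" "range r \<inter> Z = {}"
    "\<forall>i j. i \<noteq> j \<longrightarrow> (r i, r j) \<notin> R" "thin (R `` range r)"
proof -
  \<comment> \<open>Separating whole neighbourhoods by a factor of 2 gives independence and thinness
    at once: a window from \<open>m\<close> to \<open>2 * m\<close> meets at most one of the
    neighbourhoods.\<close>
  define Q where "Q s t \<longleftrightarrow> (\<forall>i\<in>R `` {s}. \<forall>j\<in>R `` {t}. 2 * i < j)" for s t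
  have fin: "finite (R `` {s})" "card (R `` {s}) \<le> D" for s
    using R(1) unfolding sparse_def by auto
  have self: "s \<in> R `` {s}" for s
    using R(3) by auto
  have step: "\<exists>t. t \<notin> Z \<and> Q s t" for s
  proof -
    \<comment> \<open>If \<open>t\<close> is a neighbour of no number up to \<open>?m\<close>,
      symmetry of \<open>R\<close> puts all neighbours of \<open>t\<close> above
      \<open>?m\<close>.\<close>
    let ?m = "2 * Max (R `` {s})"
    have "finite (\<Union>j\<in>{..?m}. R `` {j})"
      using fin by blast
    then have "infinite (- Z - (\<Union>j\<in>{..?m}. R `` {j}))"
      using infinite_Compl_thin[OF Z] by (rule Diff_infinite_finite)
    then obtain t where t: "t \<notin> Z" "t \<notin> (\<Union>j\<in>{..?m}. R `` {j})"
      using infinite_imp_nonempty by blast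
    have "Q s t"
      unfolding Q_def
    proof (intro ballI, rule ccontr)
      fix i j assume i: "i \<in> R `` {s}" and j: "j \<in> R `` {t}" and "\<not> 2 * i < j"
      then have "j \<le> ?m"
        using Max_ge[OF fin(1) i] by linarith
      moreover have "t \<in> R `` {j}"
        using j R(2) by (auto dest: symD)
      ultimately show False
        using t(2) by blast
    qed
    then show ?thesis
      using t(1) by blast
  qed
  have "\<exists>r. \<forall>n. r n \<notin> Z \<and> Q (r n) (r (Suc n))"
    by (rule dependent_nat_choice) (use step in blast)+
  then obtain r where r: "\<And>n. r n \<notin> Z" "\<And>n. Q (r n) (r (Suc n))"
    by blast
  have Q_less: "Q (r i) (r j)" if "i < j" for i j
    using that
  proof (induction rule: less_Suc_induct)
    case (2 i j k)
    show ?case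
      unfolding Q_def
    proof (intro ballI)
      fix x y assume "x \<in> R `` {r i}" "y \<in> R `` {r k}"
      then have "2 * x < r j" "2 * r j < y"
        using 2 self unfolding Q_def by blast+
      then show "2 * x < y"
        by linarith
    qed
  qed (rule r)
  have not_R: "(r i, r j) \<notin> R" if "i < j" for i j
  proof
    assume "(r i, r j) \<in> R"
    then have "2 * r j < r j"
      using Q_less[OF that] self[of "r j"] unfolding Q_def by blast
    then show False
      by simp
  qed
  have not_R': "(r i, r j) \<notin> R" if "i \<noteq> j" for i j
    using not_R[of i j] not_R[of j i] that R(2) by (auto simp: neq_iff dest: symD)
  have "inj r"
  proof (rule injI, rule ccontr)
    fix i j assume "r i = r j" "i \<noteq> j"
    then show False
      using not_R'[of i j] self[of "r i"] by auto
  qed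
  moreover have "card (R `` range r \<inter> {m..2 * m}) \<le> D" for m
  proof (cases "R `` range r \<inter> {m..2 * m} = {}")
    case False
    then obtain x i where x: "x \<in> R `` {r i}" "m \<le> x" "x \<le> 2 * m"
      by auto
    have "R `` range r \<inter> {m..2 * m} \<subseteq> R `` {r i}"
    proof
      fix y assume "y \<in> R `` range r \<inter> {m..2 * m}"
      then obtain j where y: "y \<in> R `` {r j}" "m \<le> y" "y \<le> 2 * m"
        by auto
      have "2 * x < y" if "i < j"
        using Q_less[OF that] x(1) y(1) unfolding Q_def by blast
      moreover have "2 * y < x" if "j < i"
        using Q_less[OF that] x(1) y(1) unfolding Q_def by blast
      ultimately have "i = j"
        using x y by (cases i j rule: linorder_cases) auto
      then show "y \<in> R `` {r i}"
        using y(1) by simp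
    qed
    then show ?thesis
      using card_mono[OF fin(1)] fin(2) order_trans by blast
  qed simp
  then have "thin (R `` range r)"
    unfolding thin_def by blast
  moreover have "range r \<inter> Z = {}"
    using r(1) by blast
  ultimately show thesis
    using not_R' that by simp
qed

text \<open>
  A later set \<open>F\<close> has to avoid only the \<open>F'\<close>-neighbours of the sequences of its subsets \<open>F'\<close>,
  which are known when \<open>F'\<close> is treated. Their thinness leaves room for all later choices.
\<close>

lemma coherent_sequences:
  fixes adj :: "'f set \<Rightarrow> nat rel"
  assumes sparse: "\<And>F. finite F \<Longrightarrow> F \<subseteq> I \<Longrightarrow> \<exists>D. sparse D (adj F)"
    and sym: "\<And>F. sym (adj F)" and refl: "\<And>F. Id \<subseteq> adj F"
  obtains \<rho> :: "'f set \<Rightarrow> nat \<Rightarrow> nat" where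
    "\<And>F. finite F \<Longrightarrow> F \<subseteq> I \<Longrightarrow> inj (\<rho> F)"
    "\<And>F i j. finite F \<Longrightarrow> F \<subseteq> I \<Longrightarrow> i \<noteq> j \<Longrightarrow> (\<rho> F i, \<rho> F j) \<notin> adj F"
    "\<And>F G. finite F \<Longrightarrow> F \<subseteq> I \<Longrightarrow> G \<subset> F \<Longrightarrow> range (\<rho> F) \<inter> adj G `` range (\<rho> G) = {}"
proof -
  define P where "P f F r \<longleftrightarrow> (finite F \<longrightarrow> F \<subseteq> I \<longrightarrow> inj r \<and>
    (\<forall>i j. i \<noteq> j \<longrightarrow> (r i, r j) \<notin> adj F) \<and>
    (\<forall>F'. F' \<subset> F \<longrightarrow> range r \<inter> adj F' `` range (f F') = {}) \<and> thin (adj F `` range r))"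
    for f :: "'f set \<Rightarrow> nat \<Rightarrow> nat" and F :: "'f set" and r :: "nat \<Rightarrow> nat"
  have "\<exists>\<rho>. \<forall>F. P \<rho> F (\<rho> F)"
  proof (rule dependent_wf_choice[OF wf_finite_psubset])
    show "P f F r = P g F r" if "\<And>G. (G, F) \<in> finite_psubset \<Longrightarrow> f G = g G" for f g F r
    proof (cases "finite F")
      case True
      then have "f G = g G" if "G \<subset> F" for G
        using \<open>\<And>G. (G, F) \<in> finite_psubset \<Longrightarrow> f G = g G\<close> that by simp
      then have "(\<forall>G. G \<subset> F \<longrightarrow> range r \<inter> adj G `` range (f G) = {}) \<longleftrightarrow>
          (\<forall>G. G \<subset> F \<longrightarrow> range r \<inter> adj G `` range (g G) = {})"
        by metis
      then show ?thesis
        unfolding P_def by (simp only:)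
    qed (simp add: P_def)
    show "\<exists>r. P f F r" if IH: "\<And>G. (G, F) \<in> finite_psubset \<Longrightarrow> P f G (f G)" for F f
    proof (cases "finite F \<and> F \<subseteq> I")
      case True
      then obtain D where D: "sparse D (adj F)"
        using sparse by blast
      have "thin (\<Union>G\<in>{G. G \<subset> F}. adj G `` range (f G))"
      proof (rule thin_UN)
        show "finite {G. G \<subset> F}"
          using True by (auto intro: finite_subset[of _ "Pow F"])
        fix G assume "G \<in> {G. G \<subset> F}"
        then have "P f G (f G)" "finite G" "G \<subseteq> I"
          using IH[of G] True by (auto intro: finite_subset)
        then show "thin (adj G `` range (f G))"
          by (simp add: P_def)
      qed
      then obtain r :: "nat \<Rightarrow> nat" where r: "inj r" "range r \<inter> (\<Union>G\<in>{G. G \<subset> F}. adj G `` range (f G)) = {}"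
        "\<forall>i j. i \<noteq> j \<longrightarrow> (r i, r j) \<notin> adj F" "thin (adj F `` range r)"
        by (rule sparse_independent_sequence[OF D sym refl])
      have "range r \<inter> adj G `` range (f G) = {}" if "G \<subset> F" for G
      proof -
        have "adj G `` range (f G) \<subseteq> (\<Union>G\<in>{G. G \<subset> F}. adj G `` range (f G))"
          using that by (intro UN_upper) simp
        from Int_mono[OF order_refl this, of "range r"] show ?thesis
          unfolding r(2) by simp
      qed
      with r have "P f F r"
        unfolding P_def by simp
      then show ?thesis
        by (rule exI[of _ r])
    qed (auto simp: P_def)
  qed
  then obtain \<rho> where "\<And>F. P \<rho> F (\<rho> F)"
    by blast
  then show thesis
    unfolding P_def by (intro that[of \<rho>]) simp_all
qed

section \<open>Orthonormal bases and shift operators\<close>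

lemma scaleC_one: "1 *\<^sub>C x = (x :: 'a::chilbert_space)"
  using scaleC_of_real[of 1 x] by simp

lemma scaleC_zero_left: "0 *\<^sub>C x = (0 :: 'a::chilbert_space)"
  using scaleC_of_real[of 0 x] by simp

lemma scaleC_zero_right: "c *\<^sub>C (0 :: 'a::chilbert_space) = 0"
  using scaleC_scaleC[of c 0 0] by (simp add: scaleC_zero_left)

lemma cinner_zero_left [simp]: "cinner 0 y = 0"
  using cinner_add_left[of 0 0 y] by simp

lemma cinner_zero_right [simp]: "cinner y 0 = 0"
  by (subst cinner_commute) simp

lemma cinner_add_right: "cinner x (y + z) = cinner x y + cinner x z"
  by (metis cinner_add_left cinner_commute complex_cnj_add)

lemma cinner_scaleC_right: "cinner x (c *\<^sub>C y) = cnj c * cinner x y"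
  by (metis cinner_scaleC_left cinner_commute complex_cnj_mult)

lemma cinner_scaleR_left: "cinner (r *\<^sub>R x) y = r *\<^sub>R cinner x y"
  by (metis cinner_scaleC_left scaleC_of_real scaleR_conv_of_real)

lemma cinner_scaleR_right: "cinner x (r *\<^sub>R y) = r *\<^sub>R cinner x y"
  by (metis cinner_scaleC_right scaleC_of_real scaleR_conv_of_real complex_cnj_complex_of_real)

lemma cinner_diff_left: "cinner (x - y) z = cinner x z - cinner y z"
  using cinner_add_left[of "x - y" y z] by simp

lemma cinner_diff_right: "cinner z (x - y) = cinner z x - cinner z y"
  using cinner_add_right[of z "x - y" y] by simp

lemma cinner_sum_left: "cinner (sum f A) y = (\<Sum>i\<in>A. cinner (f i) y)"
  by (induction A rule: infinite_finite_induct) (auto simp: cinner_add_left)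

lemma cinner_sum_right: "cinner y (sum f A) = (\<Sum>i\<in>A. cinner y (f i))"
  by (induction A rule: infinite_finite_induct) (auto simp: cinner_add_right)

lemma norm_eq_1_cinner:
  assumes "cinner x x = 1"
  shows "norm x = 1"
proof -
  have "complex_of_real ((norm x)\<^sup>2) = complex_of_real 1"
    using assms by (simp add: cinner_self)
  then have "(norm x)\<^sup>2 = 1"
    by (simp only: of_real_eq_iff)
  then show ?thesis
    by (simp add: power2_eq_1_iff) (smt (verit) norm_ge_zero)
qed

lemma norm_diff_sq_cinner:
  "complex_of_real ((norm (x - y))\<^sup>2) =
    complex_of_real ((norm x)\<^sup>2) - cinner x y - cinner y x + complex_of_real ((norm y)\<^sup>2)"
  unfolding cinner_self[symmetric] by (simp add: cinner_diff_left cinner_diff_right)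

text \<open>The hypothesis says that \<open>x - p\<close> is orthogonal to \<open>p\<close>, so
  Pythagoras applies. Cauchy-Schwarz, Bessel and the contractivity of left inverses of isometries
  are obtained from it.\<close>

lemma cinner_projection_norm_le:
  assumes "cinner x p = complex_of_real ((norm p)\<^sup>2)"
  shows "norm p \<le> norm x"
proof -
  have "cinner p x = complex_of_real ((norm p)\<^sup>2)"
    by (subst cinner_commute) (simp add: assms)
  then have "complex_of_real ((norm (x - p))\<^sup>2) = complex_of_real ((norm x)\<^sup>2 - (norm p)\<^sup>2)"
    by (simp add: norm_diff_sq_cinner assms del: of_real_power)
  then have "(norm (x - p))\<^sup>2 = (norm x)\<^sup>2 - (norm p)\<^sup>2"
    by (simp only: of_real_eq_iff)
  then have "(norm p)\<^sup>2 \<le> (norm x)\<^sup>2"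
    by (smt (verit) zero_le_power2)
  then show ?thesis
    using norm_ge_zero power2_le_imp_le by blast
qed

lemma Cauchy_Schwarz_cinner: "cmod (cinner x y) \<le> norm x * norm y"
proof (cases "y = 0")
  case False
  define c where "c = cinner x y / complex_of_real ((norm y)\<^sup>2)"
  have n: "norm (c *\<^sub>C y) = cmod (cinner x y) / norm y"
    using False by (simp add: norm_scaleC c_def norm_divide norm_mult power2_eq_square)
  have "cinner x (c *\<^sub>C y) = cnj (cinner x y) * cinner x y / complex_of_real ((norm y)\<^sup>2)"
    by (simp add: cinner_scaleC_right c_def)
  also have "\<dots> = complex_of_real ((norm (c *\<^sub>C y))\<^sup>2)"
    by (simp add: n power_divide complex_norm_square mult.commute del: of_real_power)
  finally have "norm (c *\<^sub>C y) \<le> norm x"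
    by (rule cinner_projection_norm_le)
  then show ?thesis
    using False by (simp add: n field_simps)
qed simp

lemma bounded_bilinear_cinner: "bounded_bilinear (cinner :: 'a::chilbert_space \<Rightarrow> 'a \<Rightarrow> complex)"
  by (rule bounded_bilinear.intro)
     (auto simp: cinner_add_left cinner_add_right cinner_scaleR_left cinner_scaleR_right
       intro!: exI[of _ 1] Cauchy_Schwarz_cinner)

lemma norm_sum_orthogonal:
  fixes u :: "'i \<Rightarrow> 'a::chilbert_space"
  assumes "finite A" "\<And>i j. i \<in> A \<Longrightarrow> j \<in> A \<Longrightarrow> i \<noteq> j \<Longrightarrow> cinner (u i) (u j) = 0"
  shows "(norm (sum u A))\<^sup>2 = (\<Sum>i\<in>A. (norm (u i))\<^sup>2)"
proof -
  have "complex_of_real ((norm (sum u A))\<^sup>2) = (\<Sum>i\<in>A. \<Sum>j\<in>A. cinner (u j) (u i))"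
    by (simp add: cinner_sum_left cinner_sum_right del: of_real_power flip: cinner_self)
  also have "\<dots> = (\<Sum>i\<in>A. \<Sum>j\<in>A. if j = i then complex_of_real ((norm (u i))\<^sup>2) else 0)"
    using assms(2) by (intro sum.cong refl) (auto simp: cinner_self)
  also have "\<dots> = complex_of_real (\<Sum>i\<in>A. (norm (u i))\<^sup>2)"
    using assms(1) by (simp add: sum.delta)
  finally show ?thesis
    by (simp only: of_real_eq_iff)
qed

text \<open>Pythagoras turns the Cauchy criterion for the squared norms into that for the
  vectors.\<close>

lemma orthogonal_series:
  fixes u :: "nat \<Rightarrow> 'a::chilbert_space"
  assumes orth: "\<And>i j. i \<noteq> j \<Longrightarrow> cinner (u i) (u j) = 0"
    and bound: "\<And>n. (\<Sum>k<n. (norm (u k))\<^sup>2) \<le> C\<^sup>2" and "C \<ge> 0"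
  shows "summable u" "norm (suminf u) \<le> C"
proof -
  have sq: "summable (\<lambda>k. (norm (u k))\<^sup>2)"
  proof (rule bounded_imp_summable)
    show "(\<Sum>k\<le>n. (norm (u k))\<^sup>2) \<le> C\<^sup>2" for n
      using bound[of "Suc n"] by (simp only: lessThan_Suc_atMost)
  qed simp
  show "summable u"
    unfolding summable_Cauchy
  proof (intro allI impI)
    fix r :: real assume "r > 0"
    then obtain N where N: "\<And>m n. m \<ge> N \<Longrightarrow> norm (\<Sum>k=m..<n. (norm (u k))\<^sup>2) < r\<^sup>2"
      using sq unfolding summable_Cauchy by (meson zero_less_power)
    have "norm (sum u {m..<n}) < r" if "m \<ge> N" for m n
    proof (rule power2_less_imp_less)
      show "(norm (sum u {m..<n}))\<^sup>2 < r\<^sup>2"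
        using N[OF that, of n] by (subst norm_sum_orthogonal) (auto simp: orth)
    qed (use \<open>r > 0\<close> in simp)
    then show "\<exists>N. \<forall>m\<ge>N. \<forall>n. norm (sum u {m..<n}) < r"
      by blast
  qed
  then have "(\<lambda>n. norm (sum u {..<n})) \<longlonglongrightarrow> norm (suminf u)"
    by (intro tendsto_norm summable_LIMSEQ)
  moreover have "norm (sum u {..<n}) \<le> C" for n
    by (rule power2_le_imp_le) (use \<open>C \<ge> 0\<close> bound[of n] orth in \<open>auto simp: norm_sum_orthogonal\<close>)
  ultimately show "norm (suminf u) \<le> C"
    by (intro LIMSEQ_le_const2) auto
qed

text \<open>The common source of the basis-to-basis isometries, their adjoints and the infinite
  direct sums.\<close>

lemma operator_series:
  fixes T :: "nat \<Rightarrow> 'a::chilbert_space \<Rightarrow> 'a"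
  assumes add: "\<And>n x y. T n (x + y) = T n x + T n y"
    and scale: "\<And>n c x. T n (c *\<^sub>C x) = c *\<^sub>C T n x"
    and orth: "\<And>m n x. m \<noteq> n \<Longrightarrow> cinner (T m x) (T n x) = 0"
    and bound: "\<And>n x. (\<Sum>k<n. (norm (T k x))\<^sup>2) \<le> (C * norm x)\<^sup>2" and "C \<ge> 0"
  shows "\<exists>a\<in>bounded_operators. norm a \<le> C \<and> (\<forall>x. (\<lambda>n. T n x) sums blinfun_apply a x)"
proof -
  define f where "f x = (\<Sum>n. T n x)" for x
  have sums: "(\<lambda>n. T n x) sums f x" and norm_f: "norm (f x) \<le> C * norm x" for x
    using orthogonal_series[of "\<lambda>n. T n x" "C * norm x"] orth bound \<open>C \<ge> 0\<close>
    by (auto simp: f_def summable_sums)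
  have f_add: "f (x + y) = f x + f y" for x y
    by (rule sums_unique2[OF sums]) (use sums_add[OF sums sums] in \<open>simp add: add\<close>)
  have f_scale: "f (c *\<^sub>C x) = c *\<^sub>C f x" for c x
    by (rule sums_unique2[OF sums])
       (use bounded_linear.sums[OF bounded_linear_scaleC sums] in \<open>simp add: scale\<close>)
  have "f (r *\<^sub>R x) = r *\<^sub>R f x" for r x
    using f_scale[of "complex_of_real r" x] by (simp only: scaleC_of_real)
  then have bl: "bounded_linear f"
    using norm_f by (intro bounded_linear_intro[of _ C]) (auto simp: f_add mult.commute)
  show ?thesis
  proof (intro bexI conjI allI)
    show "norm (Blinfun f) \<le> C"
      by (rule norm_blinfun_bound) (auto simp: bounded_linear_Blinfun_apply[OF bl] norm_f \<open>C \<ge> 0\<close>)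
    show "(\<lambda>n. T n x) sums blinfun_apply (Blinfun f) x" for x
      by (simp add: bounded_linear_Blinfun_apply[OF bl] sums)
    show "Blinfun f \<in> bounded_operators"
      by (simp add: bounded_operators_def bounded_linear_Blinfun_apply[OF bl] f_scale)
  qed
qed

lemma Bessel:
  assumes "\<And>m n :: nat. cinner (f m) (f n) = (if m = n then 1 else 0)"
  shows "(\<Sum>k<n. (cmod (cinner x (f k)))\<^sup>2) \<le> (norm x)\<^sup>2"
proof -
  have norm_f: "norm (f k) = 1" for k
    using assms[of k k] by (simp add: norm_eq_1_cinner)
  define p where "p = (\<Sum>k<n. cinner x (f k) *\<^sub>C f k)"
  have p: "(norm p)\<^sup>2 = (\<Sum>k<n. (cmod (cinner x (f k)))\<^sup>2)"
    unfolding p_def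
    by (subst norm_sum_orthogonal) (auto simp: norm_scaleC norm_f cinner_scaleC_left cinner_scaleC_right assms)
  have "cinner x p = complex_of_real (\<Sum>k<n. (cmod (cinner x (f k)))\<^sup>2)"
    unfolding p_def
    by (simp add: cinner_sum_right cinner_scaleC_right complex_norm_square mult.commute del: of_real_power)
  then have "cinner x p = complex_of_real ((norm p)\<^sup>2)"
    by (simp only: p)
  from cinner_projection_norm_le[OF this] show ?thesis
    unfolding p[symmetric] by (intro power_mono) auto
qed

definition adjoint_pair :: "('a::chilbert_space \<Rightarrow>\<^sub>L 'a) \<Rightarrow> ('a \<Rightarrow>\<^sub>L 'a) \<Rightarrow> bool" where
  "adjoint_pair a b \<longleftrightarrow> (\<forall>x y. cinner (blinfun_apply a x) y = cinner x (blinfun_apply b y))"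

text \<open>\<open>a\<close> preserves inner products because \<open>b\<close> is both its adjoint
  and a left inverse; \<open>a (b x)\<close> is then the orthogonal projection of \<open>x\<close>
  onto the range of \<open>a\<close>.\<close>

lemma adjoint_pair_norms:
  assumes "adjoint_pair a b" "b o\<^sub>L a = id_blinfun"
  shows "norm (blinfun_apply a x) = norm x" "norm (blinfun_apply b x) \<le> norm x"
    "norm a \<le> 1" "norm b \<le> 1"
proof -
  have ba: "blinfun_apply b (blinfun_apply a x) = x" for x
    by (metis assms(2) blinfun_apply_blinfun_compose blinfun_apply_id_blinfun)
  have "complex_of_real ((norm (blinfun_apply a x))\<^sup>2) = complex_of_real ((norm x)\<^sup>2)" for x
    using assms(1) by (simp add: adjoint_pair_def ba del: of_real_power flip: cinner_self)
  then have "(norm (blinfun_apply a x))\<^sup>2 = (norm x)\<^sup>2" for x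
    by (simp only: of_real_eq_iff)
  then show a: "norm (blinfun_apply a x) = norm x" for x
    by simp
  have "cinner x (blinfun_apply a (blinfun_apply b x)) =
      complex_of_real ((norm (blinfun_apply a (blinfun_apply b x)))\<^sup>2)" for x
  proof -
    have "cinner x (blinfun_apply a (blinfun_apply b x)) = cnj (cinner (blinfun_apply b x) (blinfun_apply b x))"
      using assms(1) by (metis adjoint_pair_def cinner_commute)
    then show ?thesis
      by (simp add: cinner_self a)
  qed
  from cinner_projection_norm_le[OF this]
  show b: "norm (blinfun_apply b x) \<le> norm x" for x
    by (simp add: a)
  show "norm a \<le> 1" "norm b \<le> 1"
    using a b by (auto intro!: norm_blinfun_bound)
qed

section \<open>Operators determined by their values on the basis\<close>

locale onb =
  fixes e :: "nat \<Rightarrow> 'a::chilbert_space"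
  assumes onb: "orthonormal_basis e"
begin

lemma cinner_e: "cinner (e m) (e n) = (if m = n then 1 else 0)"
  using onb unfolding orthonormal_basis_def by blast

lemma norm_e [simp]: "norm (e n) = 1"
  using cinner_e[of n n] by (simp add: norm_eq_1_cinner)

lemma dense_induct:
  assumes "closed S" "0 \<in> S" "\<And>x y. x \<in> S \<Longrightarrow> y \<in> S \<Longrightarrow> x + y \<in> S"
    "\<And>c x. x \<in> S \<Longrightarrow> c *\<^sub>C x \<in> S" "\<And>n. e n \<in> S"
  shows "x \<in> S"
proof -
  interpret C: vector_space "scaleC :: complex \<Rightarrow> 'a \<Rightarrow> 'a"
    by (rule vector_space_scaleC)
  have "C.span (range e) \<subseteq> S"
    by (rule C.span_minimal) (use assms in \<open>auto simp: C.subspace_def\<close>)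
  then have "closure (C.span (range e)) \<subseteq> S"
    using assms(1) by (rule closure_minimal)
  then show ?thesis
    using onb unfolding orthonormal_basis_def by blast
qed

lemma bounded_operators_eqI:
  assumes "a \<in> bounded_operators" "b \<in> bounded_operators"
    "\<And>n. blinfun_apply a (e n) = blinfun_apply b (e n)"
  shows "a = b"
proof (rule blinfun_eqI)
  fix x
  have "x \<in> {x. blinfun_apply a x = blinfun_apply b x}"
  proof (rule dense_induct)
    show "closed {x. blinfun_apply a x = blinfun_apply b x}"
      by (intro closed_Collect_eq continuous_intros)
  qed (use assms in \<open>auto simp: blinfun.bilinear_simps bounded_operators_def\<close>)
  then show "blinfun_apply a x = blinfun_apply b x"
    by simp
qed

lemma adjoint_pairI:
  assumes "a \<in> bounded_operators" "b \<in> bounded_operators"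
    "\<And>m n. cinner (blinfun_apply a (e m)) (e n) = cinner (e m) (blinfun_apply b (e n))"
  shows "adjoint_pair a b"
proof -
  note cont = bounded_bilinear.continuous_on[OF bounded_bilinear_cinner]
  have 1: "x \<in> {x. cinner (blinfun_apply a x) (e n) = cinner x (blinfun_apply b (e n))}" for x n
  proof (rule dense_induct)
    show "closed {x. cinner (blinfun_apply a x) (e n) = cinner x (blinfun_apply b (e n))}"
      by (intro closed_Collect_eq cont continuous_intros)
  qed (use assms in \<open>auto simp: blinfun.bilinear_simps bounded_operators_def cinner_add_left cinner_scaleC_left\<close>)
  have 2: "y \<in> {y. cinner (blinfun_apply a x) y = cinner x (blinfun_apply b y)}" for x y
  proof (rule dense_induct)
    show "closed {y. cinner (blinfun_apply a x) y = cinner x (blinfun_apply b y)}"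
      by (intro closed_Collect_eq cont continuous_intros)
  qed (use assms 1 in \<open>auto simp: blinfun.bilinear_simps bounded_operators_def cinner_add_right cinner_scaleC_right\<close>)
  then show ?thesis
    unfolding adjoint_pair_def by blast
qed

lemma operator_of_orthonormal:
  assumes f: "\<And>m n. cinner (f m) (f n) = (if m = n then 1 else 0)"
    and g: "\<And>m n. cinner (g m) (g n) = (if m = n then 1 else 0)"
  shows "\<exists>a\<in>bounded_operators. \<forall>x. (\<lambda>n. cinner x (f n) *\<^sub>C g n) sums blinfun_apply a x"
proof -
  have norm_g: "norm (g n) = 1" for n
    using g[of n n] by (simp add: norm_eq_1_cinner)
  have "\<exists>a\<in>bounded_operators. norm a \<le> 1 \<and> (\<forall>x. (\<lambda>n. cinner x (f n) *\<^sub>C g n) sums blinfun_apply a x)"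
  proof (rule operator_series)
    show "(\<Sum>k<n. (norm (cinner x (f k) *\<^sub>C g k))\<^sup>2) \<le> (1 * norm x)\<^sup>2" for n x
      using Bessel[of f x n] f by (simp add: norm_scaleC norm_g)
  qed (auto simp: cinner_add_left cinner_scaleC_left cinner_scaleC_right g scaleC_add_left scaleC_scaleC)
  then show ?thesis
    by blast
qed

text \<open>The series defines a bounded complex-linear operator that fixes every basis
  vector.\<close>

lemma expansion: "(\<lambda>n. cinner x (e n) *\<^sub>C e n) sums x"
proof -
  obtain a where a: "a \<in> bounded_operators"
    "\<And>x. (\<lambda>n. cinner x (e n) *\<^sub>C e n) sums blinfun_apply a x"
    using operator_of_orthonormal[OF cinner_e cinner_e] by blast
  have "a = id_blinfun"
  proof (rule bounded_operators_eqI)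
    fix m
    have "(\<lambda>n. cinner (e m) (e n) *\<^sub>C e n) = (\<lambda>n. if n = m then e m else 0)"
      by (auto simp: cinner_e scaleC_one scaleC_zero_left)
    then show "blinfun_apply a (e m) = blinfun_apply id_blinfun (e m)"
      using sums_unique2[OF a(2)[of "e m"]] sums_single[of m "\<lambda>_. e m"] by simp
  qed (use a(1) in \<open>auto simp: bounded_operators_def\<close>)
  then show ?thesis
    using a(2)[of x] by simp
qed

lemma shift_exists:
  assumes "inj r"
  shows "\<exists>a\<in>bounded_operators. \<forall>n. blinfun_apply a (e n) = e (r n)"
    and "\<exists>b\<in>bounded_operators. (\<forall>n. blinfun_apply b (e (r n)) = e n) \<and>
      (\<forall>m. m \<notin> range r \<longrightarrow> blinfun_apply b (e m) = 0)"
proof -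
  have er: "cinner (e (r m)) (e (r n)) = (if m = n then 1 else 0)" for m n
    using assms by (auto simp: cinner_e dest: injD)
  obtain a where a: "a \<in> bounded_operators"
    "\<And>x. (\<lambda>n. cinner x (e n) *\<^sub>C e (r n)) sums blinfun_apply a x"
    using operator_of_orthonormal[OF cinner_e er] by blast
  have "blinfun_apply a (e m) = e (r m)" for m
  proof -
    have "(\<lambda>n. cinner (e m) (e n) *\<^sub>C e (r n)) = (\<lambda>n. if n = m then e (r m) else 0)"
      by (auto simp: cinner_e scaleC_one scaleC_zero_left)
    then show ?thesis
      using sums_unique2[OF a(2)[of "e m"]] sums_single[of m "\<lambda>_. e (r m)"] by simp
  qed
  with a(1) show "\<exists>a\<in>bounded_operators. \<forall>n. blinfun_apply a (e n) = e (r n)"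
    by blast
  obtain b where b: "b \<in> bounded_operators"
    "\<And>x. (\<lambda>n. cinner x (e (r n)) *\<^sub>C e n) sums blinfun_apply b x"
    using operator_of_orthonormal[OF er cinner_e] by blast
  have "blinfun_apply b (e (r m)) = e m" for m
  proof -
    have "(\<lambda>n. cinner (e (r m)) (e (r n)) *\<^sub>C e n) = (\<lambda>n. if n = m then e m else 0)"
      by (auto simp: er scaleC_one scaleC_zero_left)
    then show ?thesis
      using sums_unique2[OF b(2)[of "e (r m)"]] sums_single[of m "\<lambda>_. e m"] by simp
  qed
  moreover have "blinfun_apply b (e m) = 0" if "m \<notin> range r" for m
  proof -
    have "(\<lambda>n. cinner (e m) (e (r n)) *\<^sub>C e n) = (\<lambda>n. 0)"
    proof
      fix n
      have "m \<noteq> r n"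
        using that by auto
      then show "cinner (e m) (e (r n)) *\<^sub>C e n = 0"
        by (simp add: cinner_e scaleC_zero_left)
    qed
    then show ?thesis
      using sums_unique2[OF b(2)[of "e m"]] by simp
  qed
  ultimately show "\<exists>b\<in>bounded_operators. (\<forall>n. blinfun_apply b (e (r n)) = e n) \<and>
      (\<forall>m. m \<notin> range r \<longrightarrow> blinfun_apply b (e m) = 0)"
    using b(1) by blast
qed

definition shift where
  "shift r = (SOME a. a \<in> bounded_operators \<and> (\<forall>n. blinfun_apply a (e n) = e (r n)))"

definition coshift where
  "coshift r = (SOME b. b \<in> bounded_operators \<and> (\<forall>n. blinfun_apply b (e (r n)) = e n) \<and>
      (\<forall>m. m \<notin> range r \<longrightarrow> blinfun_apply b (e m) = 0))"

lemma
  assumes "inj r"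
  shows shift_bounded: "shift r \<in> bounded_operators"
    and shift_e: "blinfun_apply (shift r) (e n) = e (r n)"
  using someI_ex[OF shift_exists(1)[OF assms, unfolded Bex_def]] unfolding shift_def by auto

lemma
  assumes "inj r"
  shows coshift_bounded: "coshift r \<in> bounded_operators"
    and coshift_e: "blinfun_apply (coshift r) (e (r n)) = e n"
    and coshift_e_0: "m \<notin> range r \<Longrightarrow> blinfun_apply (coshift r) (e m) = 0"
  using someI_ex[OF shift_exists(2)[OF assms, unfolded Bex_def]] unfolding coshift_def by auto

lemma bounded_operators_compose:
  "a \<in> bounded_operators \<Longrightarrow> b \<in> bounded_operators \<Longrightarrow> a o\<^sub>L b \<in> bounded_operators"
  by (simp add: bounded_operators_def)

lemma id_bounded: "id_blinfun \<in> bounded_operators"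
  by (simp add: bounded_operators_def)

lemma zero_bounded: "0 \<in> bounded_operators"
  by (simp add: bounded_operators_def scaleC_zero_right)

lemma shift_adjoint:
  assumes "inj r"
  shows "adjoint_pair (shift r) (coshift r)"
proof (rule adjoint_pairI[OF shift_bounded[OF assms] coshift_bounded[OF assms]])
  fix m n
  show "cinner (blinfun_apply (shift r) (e m)) (e n) = cinner (e m) (blinfun_apply (coshift r) (e n))"
  proof (cases "n \<in> range r")
    case True
    then obtain k where "n = r k"
      by blast
    then show ?thesis
      by (simp add: shift_e coshift_e cinner_e assms inj_eq)
  next
    case False
    then have "r m \<noteq> n"
      by blast
    with False show ?thesis
      by (simp add: shift_e coshift_e_0 cinner_e assms)
  qed
qed

lemma coshift_shift:
  assumes "inj r"
  shows "coshift r o\<^sub>L shift r = id_blinfun"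
  by (rule bounded_operators_eqI)
     (auto simp: assms shift_e coshift_e intro!: bounded_operators_compose shift_bounded coshift_bounded id_bounded)

lemma coshift_shift_disjoint:
  assumes "inj r" "inj s" "range r \<inter> range s = {}"
  shows "coshift r o\<^sub>L shift s = 0"
  by (rule bounded_operators_eqI)
     (use assms in \<open>auto simp: shift_e disjoint_iff
        intro!: coshift_e_0 bounded_operators_compose shift_bounded coshift_bounded zero_bounded\<close>)

text \<open>By adjointness the matrix entries of the compression are the entries of \<open>a\<close>
  at \<open>(r i, s j)\<close>.\<close>

lemma coshift_compose_shift_eq_0:
  assumes "inj r" "inj s" "a \<in> bounded_operators" "\<And>i j. matrix_entry e a (r i) (s j) = 0"
  shows "coshift r o\<^sub>L a o\<^sub>L shift s = 0"
proof (rule bounded_operators_eqI)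
  fix j
  have "cinner (blinfun_apply (coshift r o\<^sub>L a o\<^sub>L shift s) (e j)) (e i) = 0" for i
  proof -
    have "cinner (e i) (blinfun_apply (coshift r o\<^sub>L a o\<^sub>L shift s) (e j))
        = cinner (e (r i)) (blinfun_apply a (e (s j)))"
      using shift_adjoint[OF assms(1)] unfolding adjoint_pair_def
      by (metis assms(1,2) blinfun_apply_blinfun_compose shift_e)
    also have "\<dots> = 0"
      using assms(4)[of i j] cinner_commute[of "e (r i)"] by (simp add: matrix_entry_def)
    finally show ?thesis
      by (metis cinner_commute complex_cnj_zero)
  qed
  then show "blinfun_apply (coshift r o\<^sub>L a o\<^sub>L shift s) (e j) = blinfun_apply 0 (e j)"
    using sums_unique2[OF expansion[of "blinfun_apply (coshift r o\<^sub>L a o\<^sub>L shift s) (e j)"]]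
    by (simp add: scaleC_zero_left)
qed (use assms in \<open>auto intro!: bounded_operators_compose shift_bounded coshift_bounded zero_bounded\<close>)

end

section \<open>Banded matrices and infinite ampliation\<close>

context onb
begin

definition support :: "('a \<Rightarrow>\<^sub>L 'a) \<Rightarrow> (nat \<times> nat) set" where
  "support a = {(i, j). matrix_entry e a i j \<noteq> 0}"

lemma B_at_most_iff:
  "a \<in> B_at_most e k \<longleftrightarrow> a \<in> bounded_operators \<and> sparse k (support a) \<and> sparse k ((support a)\<inverse>)"
  by (simp add: B_at_most_def sparse_def support_def Image_def)

lemma B_infty_iff:
  "a \<in> B_infty e \<longleftrightarrow> a \<in> bounded_operators \<and> (\<exists>k. sparse k (support a \<union> (support a)\<inverse>))"
proof
  assume "a \<in> B_infty e"
  then obtain k where "a \<in> bounded_operators" "sparse k (support a)" "sparse k ((support a)\<inverse>)"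
    by (auto simp: B_infty_def B_at_most_iff)
  then show "a \<in> bounded_operators \<and> (\<exists>k. sparse k (support a \<union> (support a)\<inverse>))"
    using sparse_Un by blast
next
  assume "a \<in> bounded_operators \<and> (\<exists>k. sparse k (support a \<union> (support a)\<inverse>))"
  then obtain k where "a \<in> bounded_operators" "sparse k (support a \<union> (support a)\<inverse>)"
    by blast
  then have "a \<in> B_at_most e k"
    unfolding B_at_most_iff
    by (meson sparse_mono[OF Un_upper1 _ order_refl] sparse_mono[OF Un_upper2 _ order_refl])
  then show "a \<in> B_infty e"
    by (auto simp: B_infty_def)
qed

lemma B_inftyI:
  assumes "a \<in> bounded_operators" "sparse k R" "sparse l (R\<inverse>)" "support a \<subseteq> R"
  shows "a \<in> B_infty e"
proof -
  have "sparse (k + l) (support a \<union> (support a)\<inverse>)"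
    by (rule sparse_mono[OF _ sparse_Un[OF assms(2,3)]]) (use assms(4) in auto)
  then show ?thesis
    using assms(1) B_infty_iff by blast
qed

lemma B_inftyE:
  assumes "a \<in> B_infty e"
  obtains k where "a \<in> bounded_operators" "sparse k (support a)" "sparse k ((support a)\<inverse>)"
  using assms by (auto simp: B_infty_def B_at_most_iff)

text \<open>Expanding \<open>b (e j)\<close> in the basis writes the entry as a series of products
  of entries; off the relational composition every term is zero.\<close>

lemma support_compose:
  assumes "a \<in> bounded_operators"
  shows "support (a o\<^sub>L b) \<subseteq> support a O support b"
proof (rule subrelI, rule ccontr)
  fix i j assume ij: "(i, j) \<in> support (a o\<^sub>L b)" "(i, j) \<notin> support a O support b"
  let ?c = "\<lambda>l. cinner (blinfun_apply b (e j)) (e l)"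
  have "(\<lambda>l. blinfun_apply a (?c l *\<^sub>C e l)) sums blinfun_apply a (blinfun_apply b (e j))"
    by (rule bounded_linear.sums[OF blinfun.bounded_linear_right expansion])
  then have "(\<lambda>l. cinner (blinfun_apply a (?c l *\<^sub>C e l)) (e i)) sums
      cinner (blinfun_apply a (blinfun_apply b (e j))) (e i)"
    by (rule bounded_linear.sums[OF bounded_bilinear.bounded_linear_left[OF bounded_bilinear_cinner]])
  moreover have "cinner (blinfun_apply a (?c l *\<^sub>C e l)) (e i) = 0" for l
  proof -
    have "cinner (blinfun_apply a (?c l *\<^sub>C e l)) (e i) = matrix_entry e b l j * matrix_entry e a i l"
      using assms by (simp add: bounded_operators_def cinner_scaleC_left matrix_entry_def)
    then show ?thesis
      using ij(2) by (auto simp: support_def)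
  qed
  ultimately have "cinner (blinfun_apply a (blinfun_apply b (e j))) (e i) = 0"
    using sums_unique2[OF sums_zero] by fastforce
  then show False
    using ij(1) by (simp add: support_def matrix_entry_def)
qed

lemma B_infty_bounded: "B_infty e \<subseteq> bounded_operators"
  using B_infty_iff by blast

lemma id_B_infty: "id_blinfun \<in> B_infty e"
  by (rule B_inftyI[OF id_bounded sparse_Id, of 1])
     (auto simp: sparse_Id[simplified] support_def matrix_entry_def cinner_e split: if_splits)

lemma add_B_infty:
  assumes "a \<in> B_infty e" "b \<in> B_infty e"
  shows "a + b \<in> B_infty e"
proof -
  obtain k l where k: "a \<in> bounded_operators" "sparse k (support a)" "sparse k ((support a)\<inverse>)"
    and l: "b \<in> bounded_operators" "sparse l (support b)" "sparse l ((support b)\<inverse>)"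
    using assms by (auto elim!: B_inftyE)
  show ?thesis
  proof (rule B_inftyI)
    show "sparse (k + l) (support a \<union> support b)" "sparse (k + l) ((support a \<union> support b)\<inverse>)"
      unfolding converse_Un by (intro sparse_Un k l)+
    show "support (a + b) \<subseteq> support a \<union> support b"
      by (auto simp: support_def matrix_entry_def blinfun.bilinear_simps cinner_add_left)
    show "a + b \<in> bounded_operators"
      using k l by (simp add: bounded_operators_def blinfun.bilinear_simps scaleC_add_right)
  qed
qed

lemma scaleR_bounded:
  assumes "a \<in> bounded_operators"
  shows "r *\<^sub>R a \<in> bounded_operators"
  using assms
  by (simp add: bounded_operators_def blinfun.bilinear_simps mult.commute scaleC_scaleC flip: scaleC_of_real)

lemma scaleR_B_infty:
  assumes "a \<in> B_infty e"
  shows "r *\<^sub>R a \<in> B_infty e"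
proof -
  obtain k where k: "a \<in> bounded_operators" "sparse k (support a)" "sparse k ((support a)\<inverse>)"
    using assms by (auto elim!: B_inftyE)
  show ?thesis
    by (rule B_inftyI[OF scaleR_bounded[OF k(1)] k(2,3)])
       (auto simp: support_def matrix_entry_def blinfun.bilinear_simps cinner_scaleR_left)
qed

lemma compose_B_infty:
  assumes "a \<in> B_infty e" "b \<in> B_infty e"
  shows "a o\<^sub>L b \<in> B_infty e"
proof -
  obtain k l where k: "a \<in> bounded_operators" "sparse k (support a)" "sparse k ((support a)\<inverse>)"
    and l: "b \<in> bounded_operators" "sparse l (support b)" "sparse l ((support b)\<inverse>)"
    using assms by (auto elim!: B_inftyE)
  show ?thesis
  proof (rule B_inftyI)
    show "sparse (k * l) (support a O support b)" "sparse (l * k) ((support a O support b)\<inverse>)"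
      unfolding converse_relcomp by (intro sparse_comp k l)+
  qed (intro support_compose bounded_operators_compose k l)+
qed

sublocale operator_algebra "B_f e"
proof
  show "closed (B_f e)"
    by (simp add: B_f_def)
  show "id_blinfun \<in> B_f e"
    using id_B_infty closure_subset unfolding B_f_def by blast
  show "a + b \<in> B_f e" if mem: "a \<in> B_f e" "b \<in> B_f e" for a b
  proof -
    obtain f where f: "\<forall>n. f n \<in> B_infty e" "f \<longlonglongrightarrow> a"
      using mem(1) unfolding B_f_def closure_sequential by blast
    obtain g where g: "\<forall>n. g n \<in> B_infty e" "g \<longlonglongrightarrow> b"
      using mem(2) unfolding B_f_def closure_sequential by blast
    from f g have "\<forall>n. f n + g n \<in> B_infty e" "(\<lambda>n. f n + g n) \<longlonglongrightarrow> a + b"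
      by (auto intro: add_B_infty tendsto_add)
    then show ?thesis
      unfolding B_f_def closure_sequential by (intro exI[of _ "\<lambda>n. f n + g n"] conjI)
  qed
  show "r *\<^sub>R a \<in> B_f e" if mem: "a \<in> B_f e" for a r
  proof -
    obtain f where "\<And>n. f n \<in> B_infty e" "f \<longlonglongrightarrow> a"
      using mem unfolding B_f_def closure_sequential by blast
    then have "\<forall>n. r *\<^sub>R f n \<in> B_infty e" "(\<lambda>n. r *\<^sub>R f n) \<longlonglongrightarrow> r *\<^sub>R a"
      by (auto intro: scaleR_B_infty tendsto_intros)
    then show ?thesis
      unfolding B_f_def closure_sequential by (intro exI[of _ "\<lambda>n. r *\<^sub>R f n"] conjI)
  qed
  show "a o\<^sub>L b \<in> B_f e" if mem: "a \<in> B_f e" "b \<in> B_f e" for a b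
  proof -
    obtain f where f: "\<forall>n. f n \<in> B_infty e" "f \<longlonglongrightarrow> a"
      using mem(1) unfolding B_f_def closure_sequential by blast
    obtain g where g: "\<forall>n. g n \<in> B_infty e" "g \<longlonglongrightarrow> b"
      using mem(2) unfolding B_f_def closure_sequential by blast
    from f g have "\<forall>n. f n o\<^sub>L g n \<in> B_infty e" "(\<lambda>n. f n o\<^sub>L g n) \<longlonglongrightarrow> (a o\<^sub>L b)"
      by (auto intro: compose_B_infty bounded_bilinear.tendsto[OF bounded_bilinear_blinfun_compose])
    then show ?thesis
      unfolding B_f_def closure_sequential by (intro exI[of _ "\<lambda>n. f n o\<^sub>L g n"] conjI)
  qed
qed

lemma GL_eq: "GL = GL_f e"
  by (simp add: GL_def GL_f_def)

lemma B_infty_mem: "a \<in> B_infty e \<Longrightarrow> a \<in> B_f e"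
  unfolding B_f_def using closure_subset by blast

lemma shift_B_infty:
  assumes "inj r"
  shows "shift r \<in> B_infty e" "coshift r \<in> B_infty e"
proof -
  let ?R = "{(r n, n) |n. True}"
  have eq: "?R `` {i} = (if i \<in> range r then {inv r i} else {})" for i
    using assms by (auto simp: image_iff)
  have 1: "sparse 1 ?R"
    unfolding sparse_def eq by simp
  have "(?R\<inverse>) `` {i} = {r i}" for i
    by auto
  then have 2: "sparse 1 (?R\<inverse>)"
    unfolding sparse_def by simp
  show "shift r \<in> B_infty e"
  proof (rule B_inftyI[OF shift_bounded[OF assms] 1 2])
    show "support (shift r) \<subseteq> ?R"
      by (auto simp: support_def matrix_entry_def shift_e assms cinner_e split: if_splits)
  qed
  show "coshift r \<in> B_infty e"
  proof (rule B_inftyI[OF coshift_bounded[OF assms] 2])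
    show "sparse 1 ((?R\<inverse>)\<inverse>)"
      using 1 by simp
    show "support (coshift r) \<subseteq> (?R\<inverse>)"
    proof (rule subrelI)
      fix i j assume ij: "(i, j) \<in> support (coshift r)"
      then have "j \<in> range r"
        using coshift_e_0[OF assms, of j] by (cases "j \<in> range r") (auto simp: support_def matrix_entry_def)
      then show "(i, j) \<in> (?R\<inverse>)"
        using ij by (auto simp: support_def matrix_entry_def coshift_e assms cinner_e split: if_splits)
    qed
  qed
qed

section \<open>Infinite direct sums along a partition of the basis into rooms\<close>

abbreviation "room k \<equiv> \<lambda>j. prod_encode (k, j)"

lemma inj_room: "inj (room k)"
  by (simp add: inj_def)

lemma room_orthogonal: "coshift (room k) o\<^sub>L shift (room l) = (if k = l then id_blinfun else 0)"
  by (auto simp: coshift_shift inj_room intro!: coshift_shift_disjoint)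

lemma room_apply: "blinfun_apply (coshift (room k)) (blinfun_apply (shift (room l)) x) = (if k = l then x else 0)"
  using blinfun_compose_apply_eq[OF room_orthogonal, of k l x] by auto

lemma cinner_room_orthogonal:
  "k \<noteq> l \<Longrightarrow> cinner (blinfun_apply (shift (room k)) x) (blinfun_apply (shift (room l)) y) = 0"
  using shift_adjoint[OF inj_room] by (simp add: adjoint_pair_def room_apply)

lemma norm_room: "norm (blinfun_apply (shift (room k)) x) = norm x"
  by (rule adjoint_pair_norms(1)[OF shift_adjoint coshift_shift]) (rule inj_room)+

lemma sum_coshift_room: "(\<Sum>k<n. (norm (blinfun_apply (coshift (room k)) x))\<^sup>2) \<le> (norm x)\<^sup>2"
proof -
  let ?p = "\<Sum>k<n. blinfun_apply (shift (room k)) (blinfun_apply (coshift (room k)) x)"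
  have p: "(norm ?p)\<^sup>2 = (\<Sum>k<n. (norm (blinfun_apply (coshift (room k)) x))\<^sup>2)"
    by (subst norm_sum_orthogonal) (auto simp: cinner_room_orthogonal norm_room)
  have 1: "cinner x (blinfun_apply (shift (room k)) y) = cinner (blinfun_apply (coshift (room k)) x) y" for k y
    using shift_adjoint[OF inj_room] unfolding adjoint_pair_def by (metis cinner_commute)
  have "cinner x ?p = complex_of_real ((norm ?p)\<^sup>2)"
    unfolding p by (simp add: cinner_sum_right 1 cinner_self)
  from cinner_projection_norm_le[OF this] show ?thesis
    unfolding p[symmetric] by (intro power_mono) auto
qed

lemma ampliation_exists:
  assumes "a \<in> bounded_operators"
  shows "\<exists>d\<in>bounded_operators. norm d \<le> norm a \<and> (\<forall>x.
    (\<lambda>k. blinfun_apply (shift (room k)) (blinfun_apply a (blinfun_apply (coshift (room k)) x))) sums blinfun_apply d x)"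
proof (rule operator_series)
  show "(\<Sum>k<n. (norm (blinfun_apply (shift (room k)) (blinfun_apply a (blinfun_apply (coshift (room k)) x))))\<^sup>2)
      \<le> (norm a * norm x)\<^sup>2" for n x
  proof -
    have "(\<Sum>k<n. (norm (blinfun_apply (shift (room k)) (blinfun_apply a (blinfun_apply (coshift (room k)) x))))\<^sup>2)
      \<le> (\<Sum>k<n. (norm a * norm (blinfun_apply (coshift (room k)) x))\<^sup>2)"
      by (intro sum_mono power_mono) (auto simp: norm_room norm_blinfun)
    also have "\<dots> = (norm a)\<^sup>2 * (\<Sum>k<n. (norm (blinfun_apply (coshift (room k)) x))\<^sup>2)"
      by (simp add: power_mult_distrib sum_distrib_left)
    also have "\<dots> \<le> (norm a)\<^sup>2 * (norm x)\<^sup>2"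
      by (intro mult_left_mono sum_coshift_room) auto
    finally show ?thesis
      by (simp add: power_mult_distrib)
  qed
qed (use assms shift_bounded[OF inj_room] coshift_bounded[OF inj_room] in
    \<open>auto simp: blinfun.bilinear_simps bounded_operators_def cinner_room_orthogonal\<close>)

text \<open>The direct sum of copies of \<open>a\<close>, one in each room. The norm bound is
  recorded with the series because, applied to differences, it yields continuity.\<close>

definition ampliation :: "('a \<Rightarrow>\<^sub>L 'a) \<Rightarrow> ('a \<Rightarrow>\<^sub>L 'a)" where
  "ampliation a = (SOME d. d \<in> bounded_operators \<and> norm d \<le> norm a \<and> (\<forall>x.
    (\<lambda>k. blinfun_apply (shift (room k)) (blinfun_apply a (blinfun_apply (coshift (room k)) x))) sums blinfun_apply d x))"

context
  fixes a :: "'a \<Rightarrow>\<^sub>L 'a" assumes a: "a \<in> bounded_operators"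
begin

lemma
  shows ampliation_bounded: "ampliation a \<in> bounded_operators"
    and norm_ampliation: "norm (ampliation a) \<le> norm a"
    and ampliation_sums: "(\<lambda>k. blinfun_apply (shift (room k)) (blinfun_apply a (blinfun_apply (coshift (room k)) x)))
      sums blinfun_apply (ampliation a) x"
  using someI_ex[OF ampliation_exists[OF a, unfolded Bex_def]] unfolding ampliation_def by auto

lemma coshift_ampliation:
  "blinfun_apply (coshift (room k)) (blinfun_apply (ampliation a) x) =
   blinfun_apply a (blinfun_apply (coshift (room k)) x)"
proof -
  have "(\<lambda>l. blinfun_apply (coshift (room k)) (blinfun_apply (shift (room l)) (blinfun_apply a (blinfun_apply (coshift (room l)) x))))
      sums blinfun_apply (coshift (room k)) (blinfun_apply (ampliation a) x)"
    by (rule bounded_linear.sums[OF blinfun.bounded_linear_right ampliation_sums])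
  moreover have "(\<lambda>l. blinfun_apply (coshift (room k)) (blinfun_apply (shift (room l)) (blinfun_apply a (blinfun_apply (coshift (room l)) x))))
     = (\<lambda>l. if l = k then blinfun_apply a (blinfun_apply (coshift (room l)) x) else 0)"
    by (auto simp: room_apply)
  ultimately show ?thesis
    using sums_unique2[OF _ sums_single[of k "\<lambda>l. blinfun_apply a (blinfun_apply (coshift (room l)) x)"]] by simp
qed

lemma ampliation_shift:
  "blinfun_apply (ampliation a) (blinfun_apply (shift (room l)) x) =
   blinfun_apply (shift (room l)) (blinfun_apply a x)"
proof -
  have "(\<lambda>k. blinfun_apply (shift (room k)) (blinfun_apply a (blinfun_apply (coshift (room k)) (blinfun_apply (shift (room l)) x))))
     = (\<lambda>k. if k = l then blinfun_apply (shift (room k)) (blinfun_apply a x) else 0)"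
    by (auto simp: room_apply blinfun.bilinear_simps)
  then show ?thesis
    using sums_unique2[OF ampliation_sums[of "blinfun_apply (shift (room l)) x"]]
      sums_single[of l "\<lambda>k. blinfun_apply (shift (room k)) (blinfun_apply a x)"] by simp
qed

end

lemma ampliation_id: "ampliation id_blinfun = id_blinfun"
proof (rule bounded_operators_eqI[OF ampliation_bounded[OF id_bounded] id_bounded])
  fix n
  obtain k j where "n = prod_encode (k, j)"
    by (metis prod_decode_inverse surj_pair)
  then have "e n = blinfun_apply (shift (room k)) (e j)"
    by (simp add: shift_e inj_room)
  then show "blinfun_apply (ampliation id_blinfun) (e n) = blinfun_apply id_blinfun (e n)"
    by (simp add: ampliation_shift id_bounded)
qed

lemma ampliation_compose:
  assumes "a \<in> bounded_operators" "b \<in> bounded_operators"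
  shows "ampliation (a o\<^sub>L b) = ampliation a o\<^sub>L ampliation b"
proof (rule blinfun_eqI)
  fix x
  have "(\<lambda>k. blinfun_apply (shift (room k)) (blinfun_apply a (blinfun_apply b (blinfun_apply (coshift (room k)) x))))
      sums blinfun_apply (ampliation a) (blinfun_apply (ampliation b) x)"
    using ampliation_sums[OF assms(1), of "blinfun_apply (ampliation b) x"]
    by (simp add: coshift_ampliation assms(2))
  then show "blinfun_apply (ampliation (a o\<^sub>L b)) x = blinfun_apply (ampliation a o\<^sub>L ampliation b) x"
    using sums_unique2[OF ampliation_sums[OF bounded_operators_compose[OF assms], of x]] by simp
qed

lemma diff_bounded: "a \<in> bounded_operators \<Longrightarrow> b \<in> bounded_operators \<Longrightarrow> a - b \<in> bounded_operators"
  by (simp add: bounded_operators_def blinfun.bilinear_simps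
      linear_diff[OF bounded_linear.linear[OF bounded_linear_scaleC]])

lemma ampliation_diff:
  assumes "a \<in> bounded_operators" "b \<in> bounded_operators"
  shows "ampliation (a - b) = ampliation a - ampliation b"
proof (rule blinfun_eqI)
  fix x
  show "blinfun_apply (ampliation (a - b)) x = blinfun_apply (ampliation a - ampliation b) x"
    using sums_unique2[OF ampliation_sums[OF diff_bounded[OF assms], of x]]
      sums_diff[OF ampliation_sums[OF assms(1), of x] ampliation_sums[OF assms(2), of x]]
    by (simp add: blinfun.bilinear_simps)
qed

lemma continuous_on_ampliation: "continuous_on bounded_operators ampliation"
proof (rule lipschitz_on_continuous_on[of 1], rule lipschitz_onI)
  fix a b :: "'a \<Rightarrow>\<^sub>L 'a" assume "a \<in> bounded_operators" "b \<in> bounded_operators"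
  then show "dist (ampliation a) (ampliation b) \<le> 1 * dist a b"
    using norm_ampliation[OF diff_bounded] by (simp add: dist_norm flip: ampliation_diff)
qed simp

text \<open>A basis vector interacts only with its own room, where the pattern of \<open>a\<close>
  is copied, so the counts in rows and columns do not grow.\<close>

lemma ampliation_B_infty:
  assumes "a \<in> B_infty e"
  shows "ampliation a \<in> B_infty e"
proof -
  obtain k where k: "a \<in> bounded_operators" "sparse k (support a)" "sparse k ((support a)\<inverse>)"
    using assms by (auto elim!: B_inftyE)
  define Q where "Q R = {(prod_encode (l, i), prod_encode (l, j)) |l i j. (i, j) \<in> R}" for R
  have Q: "sparse k (Q R)" if "sparse k R" for R
    unfolding sparse_def
  proof
    fix n
    obtain l i where n: "n = prod_encode (l, i)"
      by (metis prod_decode_inverse surj_pair)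
    have eq: "Q R `` {n} = room l ` (R `` {i})"
      by (auto simp: Q_def n)
    show "finite (Q R `` {n}) \<and> card (Q R `` {n}) \<le> k"
      unfolding eq using that
      by (simp add: sparse_def card_image inj_on_def)
  qed
  have Q_conv: "(Q R)\<inverse> = Q (R\<inverse>)" for R
    by (auto simp: Q_def)
  show ?thesis
  proof (rule B_inftyI[OF ampliation_bounded[OF k(1)] Q[OF k(2)]])
    show "sparse k ((Q (support a))\<inverse>)"
      unfolding Q_conv by (rule Q[OF k(3)])
    show "support (ampliation a) \<subseteq> Q (support a)"
    proof (rule subrelI)
      fix m n assume mn: "(m, n) \<in> support (ampliation a)"
      obtain l i where m: "m = prod_encode (l, i)"
        by (metis prod_decode_inverse surj_pair)
      obtain l' j where n: "n = prod_encode (l', j)"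
        by (metis prod_decode_inverse surj_pair)
      have "matrix_entry e (ampliation a) m n =
          cinner (blinfun_apply (shift (room l')) (blinfun_apply a (e j))) (blinfun_apply (shift (room l)) (e i))"
        unfolding matrix_entry_def m n ampliation_shift[OF k(1), symmetric] by (simp add: shift_e inj_room)
      also have "\<dots> = (if l = l' then matrix_entry e a i j else 0)"
        using shift_adjoint[OF inj_room[of l']]
        by (auto simp: adjoint_pair_def room_apply matrix_entry_def)
      finally show "(m, n) \<in> Q (support a)"
        using mn by (auto simp: Q_def support_def m n split: if_splits)
    qed
  qed
qed

lemma ampliation_mem:
  assumes "a \<in> B_f e"
  shows "ampliation a \<in> B_f e"
proof -
  have "ampliation ` closure (B_infty e) \<subseteq> B_f e"
  proof (rule image_closure_subset)
    show "continuous_on (closure (B_infty e)) ampliation"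
      using B_f_subset_bounded_operators
      by (intro continuous_on_subset[OF continuous_on_ampliation]) (simp add: B_f_def)
    show "ampliation ` B_infty e \<subseteq> B_f e"
      using ampliation_B_infty B_infty_mem by blast
  qed (rule closed_carrier)
  then show ?thesis
    using assms by (auto simp: B_f_def)
qed

text \<open>Moves each room to the next one and so misses exactly room 0. Together with the shift
  into room 0 it supplies the two halves of the space used by the swindle.\<close>

definition "room_shift n = (case prod_decode n of (k, j) \<Rightarrow> prod_encode (Suc k, j))"

lemma inj_room_shift: "inj room_shift"
proof (rule injI)
  fix m n assume "room_shift m = room_shift n"
  moreover obtain k i where "prod_decode m = (k, i)"
    by fastforce
  moreover obtain l j where "prod_decode n = (l, j)"
    by fastforce
  ultimately have "prod_decode m = prod_decode n"
    by (simp add: room_shift_def)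
  then show "m = n"
    by simp
qed

lemma room_shift_room: "room_shift (prod_encode (k, j)) = prod_encode (Suc k, j)"
  by (simp add: room_shift_def)

lemma range_room_shift: "range (room 0) \<inter> range room_shift = {}"
  by (auto simp: room_shift_def split: prod.splits)

lemma shift_room_Suc: "shift (room (Suc k)) = shift room_shift o\<^sub>L shift (room k)"
  by (rule bounded_operators_eqI)
     (auto simp: shift_e inj_room inj_room_shift room_shift_room
       intro!: bounded_operators_compose shift_bounded)

text \<open>The adjoint of the preceding identity; this avoids a case distinction over the
  basis.\<close>

lemma coshift_room_Suc: "coshift (room (Suc k)) = coshift (room k) o\<^sub>L coshift room_shift"
proof (rule blinfun_eqI)
  fix x
  have "cinner (blinfun_apply (coshift (room (Suc k))) x) y =
      cinner (blinfun_apply (coshift (room k)) (blinfun_apply (coshift room_shift) x)) y" for y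
  proof -
    have "cinner y (blinfun_apply (coshift (room (Suc k))) x) =
      cinner y (blinfun_apply (coshift (room k)) (blinfun_apply (coshift room_shift) x))"
      using shift_adjoint[OF inj_room[of "Suc k"]] shift_adjoint[OF inj_room[of k]]
        shift_adjoint[OF inj_room_shift] shift_room_Suc[of k]
      unfolding adjoint_pair_def by (metis blinfun_apply_blinfun_compose)
    then show ?thesis
      by (metis cinner_commute)
  qed
  then have "cinner (blinfun_apply (coshift (room (Suc k))) x - blinfun_apply (coshift (room k)) (blinfun_apply (coshift room_shift) x)) y = 0" for y
    by (simp add: cinner_diff_left)
  then show "blinfun_apply (coshift (room (Suc k))) x = blinfun_apply (coshift (room k) o\<^sub>L coshift room_shift) x"
    using cinner_self by (metis blinfun_apply_blinfun_compose eq_iff_diff_eq_0 of_real_eq_0_iff norm_eq_zero zero_eq_power2)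
qed

text \<open>Without its term 0 the defining series is again that series, carried over by the room
  shift.\<close>

lemma ampliation_rec:
  assumes "a \<in> bounded_operators"
  shows "ampliation a = (shift (room 0) o\<^sub>L a o\<^sub>L coshift (room 0))
    + (shift room_shift o\<^sub>L ampliation a o\<^sub>L coshift room_shift)"
proof (rule blinfun_eqI)
  fix x
  let ?T = "\<lambda>k x. blinfun_apply (shift (room k)) (blinfun_apply a (blinfun_apply (coshift (room k)) x))"
  have "(\<lambda>k. blinfun_apply (shift room_shift) (?T k (blinfun_apply (coshift room_shift) x))) sums
      blinfun_apply (shift room_shift) (blinfun_apply (ampliation a) (blinfun_apply (coshift room_shift) x))"
    by (rule bounded_linear.sums[OF blinfun.bounded_linear_right ampliation_sums[OF assms]])
  then have "(\<lambda>k. ?T (Suc k) x) sums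
      blinfun_apply (shift room_shift) (blinfun_apply (ampliation a) (blinfun_apply (coshift room_shift) x))"
    by (simp add: shift_room_Suc coshift_room_Suc)
  then have "(\<lambda>k. ?T k x) sums
      (blinfun_apply (shift room_shift) (blinfun_apply (ampliation a) (blinfun_apply (coshift room_shift) x)) + ?T 0 x)"
    by (rule sums_Suc_iff[of "\<lambda>k. ?T k x", THEN iffD1, rotated])
  then show "blinfun_apply (ampliation a) x = blinfun_apply ((shift (room 0) o\<^sub>L a o\<^sub>L coshift (room 0))
    + (shift room_shift o\<^sub>L ampliation a o\<^sub>L coshift room_shift)) x"
    using sums_unique2[OF ampliation_sums[OF assms, of x]] by (simp add: blinfun.bilinear_simps)
qed

end

section \<open>The choice of the isometries\<close>

context onb
begin

text \<open>\<open>Id\<close> makes every index its own neighbour, so that avoiding neighbours also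
  gives disjoint ranges. The converses give the symmetry that the choice of sequences
  requires.\<close>

definition adjacent :: "('a \<Rightarrow>\<^sub>L 'a) set \<Rightarrow> nat rel" where
  "adjacent F = Id \<union> (\<Union>a\<in>F. support a \<union> (support a)\<inverse>)"

lemma sparse_adjacent:
  "finite F \<Longrightarrow> F \<subseteq> B_infty e \<Longrightarrow> \<exists>D. sparse D (adjacent F)"
proof (induction F rule: finite_induct)
  case empty
  then show ?case
    using sparse_Id by (auto simp: adjacent_def)
next
  case (insert a F)
  obtain D where "sparse D (adjacent F)"
    using insert by auto
  moreover obtain k where "sparse k (support a \<union> (support a)\<inverse>)"
    using insert.prems B_infty_iff by blast
  moreover have "adjacent (insert a F) = adjacent F \<union> (support a \<union> (support a)\<inverse>)"
    by (auto simp: adjacent_def)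
  ultimately show ?case
    using sparse_Un by metis
qed

lemma sym_adjacent: "sym (adjacent F)"
  by (auto simp: adjacent_def sym_def)

text \<open>\<open>j\<close> and \<open>k\<close> are the even and the odd half of one sequence.
  Independence within the sequence settles \<open>F = G\<close>; coherence between sequences settles
  proper inclusion.\<close>

lemma shifts_of_sequences:
  obtains j k :: "('a \<Rightarrow>\<^sub>L 'a) set \<Rightarrow> nat \<Rightarrow> nat" where
    "\<And>F. finite F \<Longrightarrow> F \<subseteq> B_infty e \<Longrightarrow> inj (j F)"
    "\<And>F. finite F \<Longrightarrow> F \<subseteq> B_infty e \<Longrightarrow> inj (k F)"
    "\<And>F G. finite F \<Longrightarrow> F \<subseteq> B_infty e \<Longrightarrow> finite G \<Longrightarrow> G \<subseteq> B_infty e \<Longrightarrow> F \<subseteq> G \<or> G \<subseteq> F \<Longrightarrow>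
      range (j F) \<inter> range (k G) = {}"
    "\<And>F G. finite F \<Longrightarrow> F \<subseteq> B_infty e \<Longrightarrow> finite G \<Longrightarrow> G \<subseteq> B_infty e \<Longrightarrow> F \<subset> G \<or> G \<subset> F \<Longrightarrow>
      range (j F) \<inter> range (j G) = {} \<and> range (k F) \<inter> range (k G) = {}"
    "\<And>F G a m n. finite F \<Longrightarrow> F \<subseteq> B_infty e \<Longrightarrow> finite G \<Longrightarrow> G \<subseteq> B_infty e \<Longrightarrow> F \<subseteq> G \<or> G \<subseteq> F \<Longrightarrow>
      a \<in> F \<Longrightarrow> a \<in> G \<Longrightarrow> matrix_entry e a (k F m) (j G n) = 0"
proof -
  obtain \<rho> :: "('a \<Rightarrow>\<^sub>L 'a) set \<Rightarrow> nat \<Rightarrow> nat" where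
    inj: "\<And>F. finite F \<Longrightarrow> F \<subseteq> B_infty e \<Longrightarrow> inj (\<rho> F)" and
    indep: "\<And>F i j. finite F \<Longrightarrow> F \<subseteq> B_infty e \<Longrightarrow> i \<noteq> j \<Longrightarrow> (\<rho> F i, \<rho> F j) \<notin> adjacent F" and
    disj: "\<And>F G. finite F \<Longrightarrow> F \<subseteq> B_infty e \<Longrightarrow> G \<subset> F \<Longrightarrow> range (\<rho> F) \<inter> adjacent G `` range (\<rho> G) = {}"
    by (rule coherent_sequences[of "B_infty e" adjacent])
       (use sparse_adjacent sym_adjacent in \<open>auto simp: adjacent_def\<close>)
  define j where "j F n = \<rho> F (2 * n)" for F n
  define k where "k F n = \<rho> F (2 * n + 1)" for F n
  \<comment> \<open>The intersection is the smaller of the two sets; the sequence of the larger one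
    was chosen to avoid the neighbours taken with respect to the smaller.\<close>
  have not_adjacent: "(\<rho> F m, \<rho> G n) \<notin> adjacent (F \<inter> G)"
    if "finite F" "F \<subseteq> B_infty e" "finite G" "G \<subseteq> B_infty e" "F \<subset> G \<or> G \<subset> F" for F G m n
    using that(5)
  proof
    assume "F \<subset> G"
    then have "\<rho> G n \<notin> adjacent F `` range (\<rho> F)"
      using disj[OF that(3,4), of F] by blast
    then show ?thesis
      using \<open>F \<subset> G\<close> by (auto simp: inf.absorb1)
  next
    assume "G \<subset> F"
    then have "\<rho> F m \<notin> adjacent G `` range (\<rho> G)"
      using disj[OF that(1,2), of G] by blast
    then show ?thesis
      using \<open>G \<subset> F\<close> sym_adjacent[of G] by (auto simp: inf.absorb2 dest: symD)
  qed
  have not_eq: "\<rho> F m \<noteq> \<rho> G n"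
    if "finite F" "F \<subseteq> B_infty e" "finite G" "G \<subseteq> B_infty e" "F \<subset> G \<or> G \<subset> F" for F G m n
    using not_adjacent[OF that, of m n] by (auto simp: adjacent_def)
  show thesis
  proof (rule that[of j k])
    show "inj (j F)" "inj (k F)" if "finite F" "F \<subseteq> B_infty e" for F
      using inj[OF that] by (auto intro!: injI simp: j_def k_def inj_eq)
    show "range (j F) \<inter> range (k G) = {}"
      if "finite F" "F \<subseteq> B_infty e" "finite G" "G \<subseteq> B_infty e" "F \<subseteq> G \<or> G \<subseteq> F" for F G
    proof (cases "F = G")
      case True
      have "2 * m \<noteq> 2 * n + 1" for m n :: nat
        by presburger
      then show ?thesis
        by (auto simp: True j_def k_def inj_eq[OF inj[OF that(3,4)]] simp del: mult_Suc_right)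
    next
      case False
      then show ?thesis
        using not_eq[OF that(1-4)] that(5) by (auto simp: j_def k_def)
    qed
    show "range (j F) \<inter> range (j G) = {} \<and> range (k F) \<inter> range (k G) = {}"
      if "finite F" "F \<subseteq> B_infty e" "finite G" "G \<subseteq> B_infty e" "F \<subset> G \<or> G \<subset> F" for F G
      using not_eq[OF that] by (auto simp: j_def k_def)
    show "matrix_entry e a (k F m) (j G n) = 0"
      if "finite F" "F \<subseteq> B_infty e" "finite G" "G \<subseteq> B_infty e" "F \<subseteq> G \<or> G \<subseteq> F" "a \<in> F" "a \<in> G"
      for F G a m n
    proof -
      have "(k F m, j G n) \<notin> adjacent (F \<inter> G)"
      proof (cases "F = G")
        case True
        have "2 * m + 1 \<noteq> 2 * n"
          by presburger
        then show ?thesis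
          using indep[OF that(3,4)] unfolding True j_def k_def by simp
      next
        case False
        then show ?thesis
          using not_adjacent[OF that(1-4)] that(5) by (auto simp: j_def k_def)
      qed
      then show ?thesis
        using that(6,7) by (auto simp: adjacent_def support_def)
    qed
  qed
qed

lemma UNIV_nontrivial: "(UNIV :: 'a set) \<noteq> {0}"
  using norm_e[of 0] by (metis UNIV_I norm_zero singletonD zero_neq_one)

text \<open>Positivity gives \<open>norm (ginv x) * norm (x - a) < 1\<close>, the smallness wanted
  later. The minimum with 1 bounds the bump, and the division by 2 compensates that both the radius
  and the distance vary with \<open>x\<close>. The value 0 outside \<open>B_infty e\<close> allows a
  whole type as index set.\<close>

definition bump where
  "bump a x = (if a \<in> B_infty e then max 0 ((min 1 (1 / norm (ginv x)) - norm (x - a)) / 2) else 0)"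

sublocale bump_family GL bump
proof
  fix x y :: "'a \<Rightarrow>\<^sub>L 'a" and a :: "'a \<Rightarrow>\<^sub>L 'a"
  assume x: "x \<in> GL"
  show "0 \<le> bump a x"
    by (simp add: bump_def)
  show "bump a x \<le> 1"
  proof -
    have "(min 1 t - r) / 2 \<le> 1" if "0 \<le> r" for t r :: real
      using that by (simp add: min_def)
    from this[OF norm_ge_zero, of "1 / norm (ginv x)" "x - a"] show ?thesis
      by (simp add: bump_def)
  qed
  show "bump a x \<le> bump a y + dist x y" if y: "y \<in> GL"
  proof -
    have "norm (y - a) \<le> norm (x - a) + norm (x - y)"
      using norm_triangle_ineq4[of "x - a" "x - y"] by simp
    moreover have "1 / norm (ginv x) \<le> 1 / norm (ginv y) + norm (x - y)"
      using inverse_norm_ginv_Lipschitz[OF x y UNIV_nontrivial] by linarith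
    moreover have "min 1 s \<le> min 1 t + d" if "s \<le> t + d" "0 \<le> d" for s t d :: real
      using that by (simp add: min_def)
    ultimately have "min 1 (1 / norm (ginv x)) - norm (x - a) \<le>
        min 1 (1 / norm (ginv y)) - norm (y - a) + 2 * norm (x - y)"
      by (smt (verit) norm_ge_zero)
    then show ?thesis
      using norm_ge_zero[of "x - y"] by (auto simp: bump_def dist_norm max_def field_simps)
  qed
  show "\<exists>a. bump a x > 0"
  proof -
    have "min 1 (1 / norm (ginv x)) > 0"
      using norm_ginv_pos[OF x UNIV_nontrivial] by simp
    then obtain a where "a \<in> B_infty e" "dist a x < min 1 (1 / norm (ginv x))"
      using GL_mem[OF x] unfolding B_f_def closure_approachable by blast
    then show ?thesis
      by (intro exI[of _ a]) (simp add: bump_def dist_norm norm_minus_commute less_max_iff_disj)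
  qed
qed

lemma active_posD:
  assumes "x \<in> GL" "F \<in> active x"
  shows "weight F x > 0" "finite F" "F \<subseteq> B_infty e"
proof -
  show pos: "weight F x > 0"
    using assms weight_nonneg[OF assms(1), of F] by simp
  show "finite F"
    by (rule weight_pos_finite[OF assms(1) pos])
  show "F \<subseteq> B_infty e"
  proof
    fix a assume "a \<in> F"
    then have "bump a x > 0"
      using weight_pos_bump[OF assms(1) pos] by blast
    then show "a \<in> B_infty e"
      by (auto simp: bump_def split: if_splits)
  qed
qed

theorem contractible_GL_B_f: "contractible GL"
proof -
  obtain j k :: "('a \<Rightarrow>\<^sub>L 'a) set \<Rightarrow> nat \<Rightarrow> nat" where
    inj: "\<And>F. finite F \<Longrightarrow> F \<subseteq> B_infty e \<Longrightarrow> inj (j F)"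
      "\<And>F. finite F \<Longrightarrow> F \<subseteq> B_infty e \<Longrightarrow> inj (k F)" and
    jk: "\<And>F G. finite F \<Longrightarrow> F \<subseteq> B_infty e \<Longrightarrow> finite G \<Longrightarrow> G \<subseteq> B_infty e \<Longrightarrow> F \<subseteq> G \<or> G \<subseteq> F \<Longrightarrow>
      range (j F) \<inter> range (k G) = {}" and
    jj_kk: "\<And>F G. finite F \<Longrightarrow> F \<subseteq> B_infty e \<Longrightarrow> finite G \<Longrightarrow> G \<subseteq> B_infty e \<Longrightarrow> F \<subset> G \<or> G \<subset> F \<Longrightarrow>
      range (j F) \<inter> range (j G) = {} \<and> range (k F) \<inter> range (k G) = {}" and
    entry: "\<And>F G a m n. finite F \<Longrightarrow> F \<subseteq> B_infty e \<Longrightarrow> finite G \<Longrightarrow> G \<subseteq> B_infty e \<Longrightarrow> F \<subseteq> G \<or> G \<subseteq> F \<Longrightarrow>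
      a \<in> F \<Longrightarrow> a \<in> G \<Longrightarrow> matrix_entry e a (k F m) (j G n) = 0"
    by (rule shifts_of_sequences) blast
  define J where "J = mix (\<lambda>F. shift (j F))"
  define J' where "J' = mix (\<lambda>F. coshift (j F))"
  define K where "K = mix (\<lambda>F. shift (k F))"
  define K' where "K' = mix (\<lambda>F. coshift (k F))"
  note defs = J_def J'_def K_def K'_def
  have mix_mem: "mix g x \<in> B_f e" if "\<And>F. F \<in> active x \<Longrightarrow> g F \<in> B_f e" for g x
    unfolding mix_def using that by (intro scaleR_mem sum_mem) auto
  have mem: "J x \<in> B_f e" "J' x \<in> B_f e" "K x \<in> B_f e" "K' x \<in> B_f e" if "x \<in> GL" for x
    unfolding defs
    by (rule mix_mem; rule B_infty_mem; rule shift_B_infty; rule inj; rule active_posD[OF that]; assumption)+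
  have chain: "F \<subseteq> G \<or> G \<subseteq> F" if "x \<in> GL" "F \<in> active x" "G \<in> active x" for x F G
    using weight_chain[OF that(1)] active_posD(1)[OF that(1)] that(2,3) by blast
  note mult = bilinear_mix[OF bounded_bilinear_blinfun_compose]
  have rel: "J' x o\<^sub>L J x = id_blinfun" "K' x o\<^sub>L K x = id_blinfun"
     "J' x o\<^sub>L K x = 0" "K' x o\<^sub>L J x = 0" if x: "x \<in> GL" for x
  proof -
    note pos = active_posD(2,3)[OF x]
    have strict: "F \<subset> G \<or> G \<subset> F" if "F \<in> active x" "G \<in> active x" "F \<noteq> G" for F G
      using chain[OF x that(1,2)] that(3) by blast
    show "J' x o\<^sub>L J x = id_blinfun"
      unfolding defs
    proof (rule mult[OF x])
      fix F G assume FG: "F \<in> active x" "G \<in> active x"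
      show "coshift (j F) o\<^sub>L shift (j G) = (if F = G then id_blinfun else 0)"
      proof (cases "F = G")
        case False
        with jj_kk[OF pos[OF FG(1)] pos[OF FG(2)] strict[OF FG]] show ?thesis
          by (simp add: coshift_shift_disjoint[OF inj(1)[OF pos[OF FG(1)]] inj(1)[OF pos[OF FG(2)]]])
      qed (simp add: coshift_shift inj pos[OF FG(2)])
    qed
    show "K' x o\<^sub>L K x = id_blinfun"
      unfolding defs
    proof (rule mult[OF x])
      fix F G assume FG: "F \<in> active x" "G \<in> active x"
      show "coshift (k F) o\<^sub>L shift (k G) = (if F = G then id_blinfun else 0)"
      proof (cases "F = G")
        case False
        with jj_kk[OF pos[OF FG(1)] pos[OF FG(2)] strict[OF FG]] show ?thesis
          by (simp add: coshift_shift_disjoint[OF inj(2)[OF pos[OF FG(1)]] inj(2)[OF pos[OF FG(2)]]])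
      qed (simp add: coshift_shift inj pos[OF FG(2)])
    qed
    show "J' x o\<^sub>L K x = 0"
      unfolding defs
    proof (rule mult[OF x])
      fix F G assume FG: "F \<in> active x" "G \<in> active x"
      show "coshift (j F) o\<^sub>L shift (k G) = (if F = G then 0 else 0)"
        using jk[OF pos[OF FG(1)] pos[OF FG(2)] chain[OF x FG]]
        by (simp add: coshift_shift_disjoint[OF inj(1)[OF pos[OF FG(1)]] inj(2)[OF pos[OF FG(2)]]])
    qed
    show "K' x o\<^sub>L J x = 0"
      unfolding defs
    proof (rule mult[OF x])
      fix F G assume FG: "F \<in> active x" "G \<in> active x"
      show "coshift (k F) o\<^sub>L shift (j G) = (if F = G then 0 else 0)"
        using jk[OF pos[OF FG(2)] pos[OF FG(1)] chain[OF x FG(2,1)]]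
        by (simp add: coshift_shift_disjoint[OF inj(2)[OF pos[OF FG(1)]] inj(1)[OF pos[OF FG(2)]]] Int_commute)
    qed
  qed
  have adjoint_mix: "adjoint_pair (mix g x) (mix h x)"
    if "\<And>F. F \<in> active x \<Longrightarrow> adjoint_pair (g F) (h F)" for g h :: "('a \<Rightarrow>\<^sub>L 'a) set \<Rightarrow> 'a \<Rightarrow>\<^sub>L 'a" and x
    using that unfolding adjoint_pair_def mix_def
    by (auto simp: blinfun.scaleR_left blinfun.sum_left cinner_scaleR_left cinner_scaleR_right
        cinner_sum_left cinner_sum_right)
  have adj: "adjoint_pair (J x) (J' x)" "adjoint_pair (K x) (K' x)" if "x \<in> GL" for x
    unfolding defs using active_posD(2,3)[OF that] inj by (auto intro!: adjoint_mix shift_adjoint)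
  have small: "norm (ginv x o\<^sub>L (K x o\<^sub>L K' x o\<^sub>L x o\<^sub>L J x o\<^sub>L J' x)) < 1" if x: "x \<in> GL" for x
  proof -
    obtain F where F: "F \<in> active x" "F \<noteq> {}" "\<And>G. G \<in> active x \<Longrightarrow> F \<subseteq> G"
      using active_least[OF x] by blast
    then obtain a where a: "a \<in> F"
      by blast
    have "bump a x > 0"
      by (rule weight_pos_bump[OF x active_posD(1)[OF x F(1)] a])
    then have "norm (x - a) < 1 / norm (ginv x)"
      by (auto simp: bump_def less_max_iff_disj split: if_splits)
    then have less: "norm (ginv x) * norm (x - a) < 1"
      using norm_ginv_pos[OF x UNIV_nontrivial] by (simp add: field_simps)
    have a_bounded: "a \<in> bounded_operators"
      using a active_posD(3)[OF x F(1)] B_infty_bounded by blast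
    have "K' x o\<^sub>L (a o\<^sub>L J x) = 0"
    proof -
      have eq: "a o\<^sub>L J x = mix (\<lambda>G. a o\<^sub>L shift (j G)) x"
        unfolding J_def mix_def
        by (simp add: bounded_bilinear.scaleR_right[OF bounded_bilinear_blinfun_compose]
            bounded_bilinear.sum_right[OF bounded_bilinear_blinfun_compose])
      show ?thesis
        unfolding eq K'_def
      proof (rule mult[OF x])
        fix G H assume GH: "G \<in> active x" "H \<in> active x"
        note pos = active_posD(2,3)[OF x]
        have "a \<in> G" "a \<in> H"
          using a F(3)[OF GH(1)] F(3)[OF GH(2)] by blast+
        then have "coshift (k G) o\<^sub>L a o\<^sub>L shift (j H) = 0"
          by (intro coshift_compose_shift_eq_0 inj pos GH a_bounded
              entry[OF pos[OF GH(1)] pos[OF GH(2)] chain[OF x GH]])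
        then show "coshift (k G) o\<^sub>L (a o\<^sub>L shift (j H)) = (if G = H then 0 else 0)"
          by (simp add: blinfun_compose_assoc)
      qed
    qed
    then have KaJ: "blinfun_apply (K' x) (blinfun_apply a (blinfun_apply (J x) v)) = 0" for v
      using blinfun_compose_apply_eq[of "K' x" "a o\<^sub>L J x" 0 v] by simp
    \<comment> \<open>By \<open>KaJ\<close> the middle factor \<open>x\<close> may be replaced by
      \<open>x - a\<close>; the outer factors are contractions.\<close>
    have "norm (K x o\<^sub>L K' x o\<^sub>L x o\<^sub>L J x o\<^sub>L J' x) \<le> norm (x - a)"
    proof (rule norm_blinfun_bound)
      fix v
      note norms = adjoint_pair_norms[OF adj(1)[OF x] rel(1)[OF x]]
        adjoint_pair_norms[OF adj(2)[OF x] rel(2)[OF x]]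
      have "norm (blinfun_apply (K x o\<^sub>L K' x o\<^sub>L x o\<^sub>L J x o\<^sub>L J' x) v)
          = norm (blinfun_apply (K' x) (blinfun_apply (x - a) (blinfun_apply (J x) (blinfun_apply (J' x) v))))"
        by (simp add: norms blinfun.bilinear_simps KaJ)
      also have "\<dots> \<le> norm (blinfun_apply (x - a) (blinfun_apply (J x) (blinfun_apply (J' x) v)))"
        by (rule norms)
      also have "\<dots> \<le> norm (x - a) * norm (blinfun_apply (J x) (blinfun_apply (J' x) v))"
        by (rule norm_blinfun)
      also have "\<dots> \<le> norm (x - a) * norm v"
        by (intro mult_left_mono) (auto simp: norms)
      finally show "norm (blinfun_apply (K x o\<^sub>L K' x o\<^sub>L x o\<^sub>L J x o\<^sub>L J' x) v) \<le> norm (x - a) * norm v" .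
    qed simp
    then have "norm (ginv x) * norm (K x o\<^sub>L K' x o\<^sub>L x o\<^sub>L J x o\<^sub>L J' x) < 1"
      using less by (meson le_less_trans mult_left_mono norm_ge_zero)
    then show ?thesis
      using norm_blinfun_compose le_less_trans by blast
  qed
  show ?thesis
  proof (rule contractible_GL[of J J' K K' "shift (room 0)" "coshift (room 0)"
        "shift room_shift" "coshift room_shift" ampliation])
    show "continuous_on GL J" "continuous_on GL J'" "continuous_on GL K" "continuous_on GL K'"
      unfolding defs by (rule continuous_on_mix)+
    show "(shift (room 0) o\<^sub>L coshift (room 0)) + (shift room_shift o\<^sub>L coshift room_shift) = id_blinfun"
      \<comment> \<open>At the identity the recursion says that the two halves fill the
        space.\<close>
      using ampliation_rec[OF id_bounded] by (simp add: ampliation_id)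
    show "coshift room_shift o\<^sub>L shift (room 0) = 0"
      using range_room_shift by (intro coshift_shift_disjoint inj_room inj_room_shift) blast
    show "continuous_on (B_f e) ampliation"
      using B_f_subset_bounded_operators by (rule continuous_on_subset[OF continuous_on_ampliation])
    show "ampliation (a o\<^sub>L b) = ampliation a o\<^sub>L ampliation b" if "a \<in> B_f e" "b \<in> B_f e" for a b
      using that B_f_subset_bounded_operators by (intro ampliation_compose) auto
    show "ampliation a = (shift (room 0) o\<^sub>L a o\<^sub>L coshift (room 0))
        + (shift room_shift o\<^sub>L ampliation a o\<^sub>L coshift room_shift)" if "a \<in> B_f e" for a
      using that B_f_subset_bounded_operators by (intro ampliation_rec) auto
  qed (simp_all add: mem rel small B_infty_mem shift_B_infty inj_room inj_room_shift coshift_shift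
      coshift_shift_disjoint range_room_shift ampliation_mem ampliation_id)
qed

end

theorem theorem6p1:
  fixes e :: "nat \<Rightarrow> 'a::chilbert_space"
  assumes "orthonormal_basis e"
  shows "contractible (GL_f e)"
proof -
  interpret onb e
    by unfold_locales (rule assms)
  show ?thesis
    using contractible_GL_B_f by (simp add: GL_eq)
qed

end
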